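(* Let $B\subset\Omega$ and let $(u_B,y_B,p_B)$ be a solution of $(\mathbf P_B)$. Then for almost all $x\in\Omega$ the topological derivative $DJ(B)(x)$ exists, and it is given by $$DJ(B)(x)=\sigma(B,x)\,\bigl(\beta(x)+\bar H(p_B(x))\bigr),\qquad \sigma(B,x):=\begin{cases}+1&\text{if }x\notin B,\\-1&\text{if }x\in B.\end{cases}$$
   Context: Setting (non-strongly convex case): $\Omega\subset\mathbb R^d$ is Lebesgue measurable with $|\Omega|<\infty$ ($|\cdot|$ is Lebesgue measure); all subsets of $\Omega$ considered are Lebesgue measurable. $Y$ is a real Hilbert space, $S:L^2(\Omega)\to Y$ is bounded linear with Hilbert space adjoint $S^*:Y\to L^2(\Omega)$, and $y_d\in Y$. $g:\mathbb R\to\mathbb R\cup\{+\infty\}$ is proper, convex, lower semicontinuous, $g\ge0$, and $g(u)=0$ if and only if $u=0$; $\operatorname{dom}g=\{u:g(u)<+\infty\}$ is a bounded subset of $\mathbb R$. There is $q>3$ such that $S^*$ is a bounded linear map from $Y$ to $L^q(\Omega)$. $\beta\in L^1(\Omega)$. Notation: for $u\in L^2(\Omega)$ and $A\subset\Omega$, $J(u,A):=\frac12\|S(\chi_Au)-y_d\|_Y^2+\int_\Omega g(u(x))+\chi_A(x)\beta(x)\,dx$, where $\chi_A$ is the characteristic function of $A$. $(\mathbf P_A)$ is the problem $\min_{u\in L^2(\Omega)}J(u,A)$, and $J(A):=\min_{u\in L^2(\Omega)}J(u,A)$ is the value function. A solution of $(\mathbf P_A)$ is a triple $(u_A,y_A,p_A)$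 where $u_A$ is a minimizer of $J(\cdot,A)$ with $\chi_Au_A=u_A$, $y_A:=S(\chi_Au_A)$ and $p_A:=S^*(y_A-y_d)$. $\bar H(p):=\min_{u\in\mathbb R}(pu+g(u))$ for $p\in\mathbb R$. Topological derivative: with $B_r(x)$ the open ball of radius $r$ centered at $x$ and $|B_r|$ its measure, $DJ(B)(x):=\lim_{r\searrow0}\frac{J((B\cup B_r(x))\cap\Omega)-J(B)}{|B_r|}$ if $x\notin B$, and $DJ(B)(x):=\lim_{r\searrow0}\frac{J(B\setminus B_r(x))-J(B)}{|B_r|}$ if $x\in B$. *)

theory Defs
  imports "HOL-Analysis.Analysis"
begin

text \<open>
  Elements of \<open>L\<^sup>p(\<Omega>)\<close> are represented by functions that are measurable with respect to Lebesgue
  measure on \<open>\<Omega>\<close>; their values outside \<open>\<Omega>\<close> play no role. Equality in \<open>L\<^sup>p(\<Omega>)\<close> is equality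
  almost everywhere on \<open>\<Omega>\<close>.
\<close>

definition Lp_space :: "real \<Rightarrow> 'a::euclidean_space set \<Rightarrow> ('a \<Rightarrow> real) set" where
  "Lp_space p \<Omega> = {f \<in> borel_measurable (lebesgue_on \<Omega>).
      integrable (lebesgue_on \<Omega>) (\<lambda>x. \<bar>f x\<bar> powr p)}"

definition Lp_norm :: "real \<Rightarrow> 'a::euclidean_space set \<Rightarrow> ('a \<Rightarrow> real) \<Rightarrow> real" where
  "Lp_norm p \<Omega> f = (integral\<^sup>L (lebesgue_on \<Omega>) (\<lambda>x. \<bar>f x\<bar> powr p)) powr (1 / p)"

text \<open>
  Linearity on representatives together with the norm bound forces \<open>S u = S v\<close> whenever \<open>u = v\<close>
  almost everywhere on \<open>\<Omega>\<close>, so the maps below are exactly the bounded linear maps on the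
  quotient space.
\<close>

definition bounded_linear_from_L2 ::
    "'a::euclidean_space set \<Rightarrow> (('a \<Rightarrow> real) \<Rightarrow> 'y::real_normed_vector) \<Rightarrow> bool" where
  "bounded_linear_from_L2 \<Omega> S \<longleftrightarrow>
     (\<forall>u\<in>Lp_space 2 \<Omega>. \<forall>v\<in>Lp_space 2 \<Omega>. S (\<lambda>x. u x + v x) = S u + S v) \<and>
     (\<forall>c. \<forall>u\<in>Lp_space 2 \<Omega>. S (\<lambda>x. c * u x) = c *\<^sub>R S u) \<and>
     (\<exists>C. \<forall>u\<in>Lp_space 2 \<Omega>. norm (S u) \<le> C * Lp_norm 2 \<Omega> u)"

definition bounded_linear_to_Lp ::
    "real \<Rightarrow> 'a::euclidean_space set \<Rightarrow> ('y::real_normed_vector \<Rightarrow> 'a \<Rightarrow> real) \<Rightarrow> bool" where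
  "bounded_linear_to_Lp p \<Omega> T \<longleftrightarrow>
     (\<forall>y. T y \<in> Lp_space p \<Omega>) \<and>
     (\<forall>y z. AE x in lebesgue_on \<Omega>. T (y + z) x = T y x + T z x) \<and>
     (\<forall>c y. AE x in lebesgue_on \<Omega>. T (c *\<^sub>R y) x = c * T y x) \<and>
     (\<exists>C. \<forall>y. Lp_norm p \<Omega> (T y) \<le> C * norm y)"

definition is_L2_adjoint ::
    "'a::euclidean_space set \<Rightarrow> (('a \<Rightarrow> real) \<Rightarrow> 'y::real_inner) \<Rightarrow> ('y \<Rightarrow> 'a \<Rightarrow> real) \<Rightarrow> bool" where
  "is_L2_adjoint \<Omega> S T \<longleftrightarrow>
     (\<forall>y. T y \<in> Lp_space 2 \<Omega>) \<and>
     (\<forall>u\<in>Lp_space 2 \<Omega>. \<forall>y. S u \<bullet> y = integral\<^sup>L (lebesgue_on \<Omega>) (\<lambda>x. u x * T y x))"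


definition ereal_proper :: "('a \<Rightarrow> ereal) \<Rightarrow> bool" where
  "ereal_proper f \<longleftrightarrow> (\<forall>x. f x \<noteq> -\<infinity>) \<and> (\<exists>x. f x < \<infinity>)"

text \<open>The case of a vanishing coefficient is harmless, since \<open>0 * \<infinity> = 0\<close> in \<^typ>\<open>ereal\<close>.\<close>

definition ereal_convex :: "('a::real_vector \<Rightarrow> ereal) \<Rightarrow> bool" where
  "ereal_convex f \<longleftrightarrow>
     (\<forall>x y. \<forall>s\<ge>0. \<forall>t\<ge>0. s + t = 1 \<longrightarrow>
        f (s *\<^sub>R x + t *\<^sub>R y) \<le> ereal s * f x + ereal t * f y)"

definition lower_semicontinuous :: "('a::topological_space \<Rightarrow> ereal) \<Rightarrow> bool" where
  "lower_semicontinuous f \<longleftrightarrow> (\<forall>x. f x \<le> Liminf (at x) f)"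

definition ereal_dom :: "('a \<Rightarrow> ereal) \<Rightarrow> 'a set" where
  "ereal_dom f = {x. f x < \<infinity>}"

text \<open>
  Integral of an extended real function, as the difference of the integrals of its positive and
  negative parts (\<^const>\<open>e2ennreal\<close> sends negative numbers to \<open>0\<close>). It is only used for
  integrands whose negative part has finite integral.
\<close>

definition ereal_integral :: "'a measure \<Rightarrow> ('a \<Rightarrow> ereal) \<Rightarrow> ereal" where
  "ereal_integral M f =
     enn2ereal (\<integral>\<^sup>+ x. e2ennreal (f x) \<partial>M) - enn2ereal (\<integral>\<^sup>+ x. e2ennreal (- f x) \<partial>M)"


definition cost ::
    "'a::euclidean_space set \<Rightarrow> (('a \<Rightarrow> real) \<Rightarrow> 'y::real_inner) \<Rightarrow> 'y \<Rightarrow> (real \<Rightarrow> ereal) \<Rightarrow>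
     ('a \<Rightarrow> real) \<Rightarrow> ('a \<Rightarrow> real) \<Rightarrow> 'a set \<Rightarrow> ereal" where
  "cost \<Omega> S yd g \<beta> u A =
     ereal (1 / 2 * (norm (S (\<lambda>x. indicator A x * u x) - yd))\<^sup>2) +
     ereal_integral (lebesgue_on \<Omega>) (\<lambda>x. g (u x) + ereal (indicator A x * \<beta> x))"

text \<open>
  Here and in the definition of \<open>hamiltonian\<close>, \<open>LEAST\<close> is the minimum in the strict sense: its
  value is only determined if the minimum is attained.
\<close>

definition value_function ::
    "'a::euclidean_space set \<Rightarrow> (('a \<Rightarrow> real) \<Rightarrow> 'y::real_inner) \<Rightarrow> 'y \<Rightarrow> (real \<Rightarrow> ereal) \<Rightarrow>
     ('a \<Rightarrow> real) \<Rightarrow> 'a set \<Rightarrow> ereal" where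
  "value_function \<Omega> S yd g \<beta> A =
     (LEAST v. v \<in> (\<lambda>u. cost \<Omega> S yd g \<beta> u A) ` Lp_space 2 \<Omega>)"

definition is_solution ::
    "'a::euclidean_space set \<Rightarrow> (('a \<Rightarrow> real) \<Rightarrow> 'y::real_inner) \<Rightarrow> ('y \<Rightarrow> 'a \<Rightarrow> real) \<Rightarrow> 'y \<Rightarrow>
     (real \<Rightarrow> ereal) \<Rightarrow> ('a \<Rightarrow> real) \<Rightarrow> 'a set \<Rightarrow> ('a \<Rightarrow> real) \<Rightarrow> 'y \<Rightarrow> ('a \<Rightarrow> real) \<Rightarrow> bool" where
  "is_solution \<Omega> S Sadj yd g \<beta> A u y p \<longleftrightarrow>
     is_arg_min (\<lambda>v. cost \<Omega> S yd g \<beta> v A) (\<lambda>v. v \<in> Lp_space 2 \<Omega>) u \<and>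
     (AE x in lebesgue_on \<Omega>. indicator A x * u x = u x) \<and>
     y = S (\<lambda>x. indicator A x * u x) \<and>
     (AE x in lebesgue_on \<Omega>. p x = Sadj (y - yd) x)"

definition hamiltonian :: "(real \<Rightarrow> ereal) \<Rightarrow> real \<Rightarrow> ereal" where
  "hamiltonian g p = (LEAST v. v \<in> range (\<lambda>u. ereal (p * u) + g u))"

text \<open>
  \<open>has_topological_derivative \<Omega> J B x D\<close>: the topological derivative at \<open>x\<close> of the set function
  \<open>J\<close> exists at \<open>B\<close> and equals the real number \<open>D\<close>.
\<close>

definition has_topological_derivative ::
    "'a::euclidean_space set \<Rightarrow> ('a set \<Rightarrow> ereal) \<Rightarrow> 'a set \<Rightarrow> 'a \<Rightarrow> real \<Rightarrow> bool" where
  "has_topological_derivative \<Omega> J B x D \<longleftrightarrow>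
     ((\<lambda>r. (J (if x \<in> B then B - ball x r else (B \<union> ball x r) \<inter> \<Omega>) - J B)
            / ereal (measure lebesgue (ball x r))) \<longlongrightarrow> ereal D) (at_right 0)"

definition topological_sign :: "'a set \<Rightarrow> 'a \<Rightarrow> real" where
  "topological_sign B x = (if x \<in> B then -1 else 1)"

end

theory Submission
  imports Defs
begin

text \<open>
  Write \<open>P = S\<^sup>*(y\<^sub>B - y\<^sub>d)\<close> and \<open>H\<close> for the Hamiltonian. The quadratic tracking term expands exactly
  around \<open>u\<^sub>B\<close>: a control \<open>u\<close> with \<open>w = \<chi>\<^sub>A u\<close> satisfies
  \<open>J(u,A) = J(B) + \<integral> (P (w - u\<^sub>B) + g(u) - g(u\<^sub>B) + (\<chi>\<^sub>A - \<chi>\<^sub>B) \<beta>) + \<parallel>S(w - u\<^sub>B)\<parallel>\<^sup>2 / 2\<close>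
  (lemma \<open>cost_expansion\<close>). Since \<open>u\<^sub>B\<close> is optimal, it minimizes \<open>P u + g(u)\<close> pointwise on \<open>B\<close>
  (\<open>pointwise_minimum_principle\<close>), and it vanishes outside \<open>B\<close>. The integrand is therefore at least
  \<open>(\<chi>\<^sub>A - \<chi>\<^sub>B)(\<beta> + H(P))\<close> for every \<open>u\<close>, and equality is attained by the control that keeps \<open>u\<^sub>B\<close>
  on \<open>A \<inter> B\<close>, is a pointwise minimizer of \<open>P u + g(u)\<close> on \<open>A - B\<close> and is \<open>0\<close> elsewhere. Hence
  \<open>0 \<le> J(A) - J(B) - \<integral> (\<chi>\<^sub>A - \<chi>\<^sub>B)(\<beta> + H(P)) \<le> \<parallel>S w\<parallel>\<^sup>2 / 2\<close>
  with a bounded \<open>w\<close> supported in the symmetric difference of \<open>A\<close> and \<open>B\<close>. The optimal controls of the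
  perturbed problems are never compared with \<open>u\<^sub>B\<close>; only one test control is.

  The remainder is small because \<open>\<parallel>S w\<parallel>\<^sup>2 = \<integral> w S\<^sup>*S w\<close> and \<open>S\<^sup>*S w\<close> is bounded in \<open>L\<^sup>q\<close> by \<open>\<parallel>S w\<parallel>\<close>:
  Hoelder's inequality gives \<open>\<parallel>S w\<parallel>\<^sup>2 \<le> K m\<^bsup>2 - 2/q\<^esup>\<close> when \<open>w\<close> lives on a set of measure at most \<open>m\<close>
  (\<open>S_small_support\<close>), and the exponent exceeds \<open>1\<close> because \<open>q > 2\<close>. With \<open>A\<close> and \<open>B\<close> differing inside a ball
  \<open>B\<^sub>r(x)\<close>, dividing by \<open>|B\<^sub>r|\<close> leaves the averages of \<open>(\<chi>\<^sub>A - \<chi>\<^sub>B)(\<beta> + H(P))\<close> over shrinking balls,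
  which converge almost everywhere by Lebesgue's differentiation theorem; that theorem is derived
  from Vitali's covering theorem.

  The value function and the Hamiltonian are attained minima, so minimizers have to be produced as
  well. For the Hamiltonian this is compactness of the closed hull of the bounded domain of \<open>g\<close>; any
  choice of minimizers is a monotone function of \<open>p\<close>, hence Borel. For the control problem
  (\<open>exists_minimizer\<close>), nearly minimal controls of nearly minimal \<open>L\<^sup>2\<close> norm form a Cauchy sequence,
  by convexity and the parallelogram law, and Fatou's lemma shows that its limit is optimal.
\<close>

section \<open>Lebesgue's differentiation theorem for balls\<close>

text \<open>
  The measure with density \<open>g\<close> is finite and does not charge \<open>F\<close>, so this is outer regularity of its
  restriction to the Borel sets.
\<close>

lemma open_superset_of_small_integral:
  fixes g :: "'a::euclidean_space \<Rightarrow> real"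
  assumes g: "integrable lebesgue g" and nonneg: "\<And>x. 0 \<le> g x"
    and F: "F \<in> sets lebesgue" and zero: "\<And>x. x \<in> F \<Longrightarrow> g x = 0"
    and e: "(0::ennreal) < e"
  obtains U where "open U" "F \<subseteq> U" "emeasure (density lebesgue g) U < e"
proof -
  let ?N = "distr (density lebesgue g) borel (\<lambda>x. x)"
  have [measurable]: "g \<in> borel_measurable lebesgue" using g by simp
  have id: "(\<lambda>x. x) \<in> density lebesgue g \<rightarrow>\<^sub>M borel" by (simp add: measurable_completion)
  have em: "emeasure ?N X = emeasure (density lebesgue g) X" if "X \<in> sets borel" for X
    using that by (subst emeasure_distr[OF id]) simp_all
  obtain C where C: "F \<subseteq> C" "C - F \<in> null_sets lebesgue" and Cb: "C \<in> sets borel"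
    using completion_upper[of F lborel] F by auto
  have fin: "emeasure ?N (space ?N) \<noteq> \<infinity>"
    using g nonneg by (simp add: em emeasure_density nn_integral_eq_integral)
  have "emeasure (density lebesgue g) C = (\<integral>\<^sup>+x. ennreal (g x) * indicator C x \<partial>lebesgue)"
    using Cb by (subst emeasure_density) auto
  also have "\<dots> = (\<integral>\<^sup>+x. 0 \<partial>(lebesgue :: 'a measure))"
  proof (rule nn_integral_cong_AE)
    show "AE x in lebesgue. ennreal (g x) * indicator C x = 0"
      using AE_not_in[OF C(2)] by eventually_elim (use zero in \<open>auto simp: indicator_def\<close>)
  qed
  finally have "emeasure ?N C = 0" by (simp add: em Cb)
  then have "(INF U\<in>{U. C \<subseteq> U \<and> open U}. emeasure ?N U) < e"
    using outer_regular[OF _ fin Cb] e by simp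
  then obtain U where U: "C \<subseteq> U" "open U" "emeasure ?N U < e"
    by (auto simp: INF_less_iff)
  show ?thesis
    by (rule that[of U]) (use U C em in auto)
qed

text \<open>
  Let \<open>F\<close> contain a set \<open>E\<close> around each point of which there are arbitrarily small balls with average
  above \<open>c\<close>. Choose an open \<open>U \<supseteq> F\<close> with \<open>\<integral>\<^sub>U g < c e\<close>. By Vitali's theorem disjoint balls of
  this kind inside \<open>U\<close> cover \<open>E\<close> up to a null set, and their total measure is at most
  \<open>\<integral>\<^sub>U g / c < e\<close>.
\<close>

lemma small_ball_averages_of_vanishing:
  fixes g :: "'a::euclidean_space \<Rightarrow> real"
  assumes g: "integrable lebesgue g" and nonneg: "\<And>x. 0 \<le> g x"
    and F: "F \<in> sets lebesgue" and zero: "\<And>x. x \<in> F \<Longrightarrow> g x = 0"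
  shows "AE x in lebesgue. x \<in> F \<longrightarrow> (\<forall>c>0. \<forall>\<^sub>F r in at_right 0.
      (LINT y|lebesgue. indicator (ball x r) y * g y) \<le> c * measure lebesgue (ball x r))"
proof -
  let ?\<nu> = "density lebesgue g"
  have [measurable]: "g \<in> borel_measurable lebesgue" using g by simp
  have \<nu>ball: "emeasure ?\<nu> (ball x r) = ennreal (LINT y|lebesgue. indicator (ball x r) y * g y)" for x r
  proof -
    have "emeasure ?\<nu> (ball x r) = (\<integral>\<^sup>+y. ennreal (indicator (ball x r) y * g y) \<partial>lebesgue)"
      by (subst emeasure_density) (auto intro!: nn_integral_cong simp: indicator_def)
    also have "\<dots> = ennreal (LINT y|lebesgue. indicator (ball x r) y * g y)"
      using integrable_mult_indicator[OF _ g, of "ball x r"] nonneg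
      by (intro nn_integral_eq_integral) auto
    finally show ?thesis .
  qed
  define Bad where "Bad c = {x \<in> F. \<forall>d>0. \<exists>r>0. r < d \<and>
      c * measure lebesgue (ball x r) < (LINT y|lebesgue. indicator (ball x r) y * g y)}" for c
  have negl: "negligible (Bad c)" if c: "c > 0" for c
    unfolding negligible_outer_le
  proof (intro allI impI)
    fix e :: real assume e: "e > 0"
    obtain U where U: "open U" "F \<subseteq> U" "emeasure ?\<nu> U < ennreal (c * e)"
      using open_superset_of_small_integral[OF g nonneg F zero, of "ennreal (c * e)"] c e by auto
    define K where "K = {(x, r). 0 < r \<and> ball x r \<subseteq> U \<and>
      c * measure lebesgue (ball x r) < (LINT y|lebesgue. indicator (ball x r) y * g y)}"
    have vit: "\<exists>i. i \<in> K \<and> x \<in> ball (fst i) (snd i) \<and> snd i < d" if xB: "x \<in> Bad c" and "0 < d" for x d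
    proof -
      have "x \<in> U" using that U by (auto simp: Bad_def)
      then obtain k where k: "k > 0" "ball x k \<subseteq> U" using U(1) openE by blast
      have P: "\<forall>d>0. \<exists>r>0. r < d \<and>
          c * measure lebesgue (ball x r) < (LINT y|lebesgue. indicator (ball x r) y * g y)"
        using xB unfolding Bad_def by simp
      have "0 < min d k" using k that by simp
      then obtain r where r: "r > 0" "r < min d k"
        "c * measure lebesgue (ball x r) < (LINT y|lebesgue. indicator (ball x r) y * g y)"
        using P by blast
      have "ball x r \<subseteq> U" using r k subset_ball[of r k x] by force
      then show ?thesis using r by (intro exI[of _ "(x, r)"]) (auto simp: K_def)
    qed
    obtain C where C: "countable C" "C \<subseteq> K"
      "pairwise (\<lambda>i j. disjnt (ball (fst i) (snd i)) (ball (fst j) (snd j))) C"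
      "negligible (Bad c - (\<Union>i\<in>C. ball (fst i) (snd i)))"
      using Vitali_covering_theorem_balls[of "Bad c" K fst snd, OF vit] by blast
    let ?V = "\<Union>i\<in>C. ball (fst i) (snd i)"
    have disj: "disjoint_family_on (\<lambda>i. ball (fst i) (snd i)) C"
      using C(3) by (auto simp: disjoint_family_on_def pairwise_def disjnt_def)
    have "ennreal c * emeasure lebesgue ?V
        = ennreal c * (\<integral>\<^sup>+i. emeasure lebesgue (ball (fst i) (snd i)) \<partial>count_space C)"
      by (subst emeasure_UN_countable) (use C disj in auto)
    also have "\<dots> = (\<integral>\<^sup>+i. ennreal c * emeasure lebesgue (ball (fst i) (snd i)) \<partial>count_space C)"
      by (simp add: nn_integral_cmult)
    also have "\<dots> \<le> (\<integral>\<^sup>+i. emeasure ?\<nu> (ball (fst i) (snd i)) \<partial>count_space C)"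
    proof (intro nn_integral_mono)
      fix i assume "i \<in> space (count_space C)"
      then have "c * measure lebesgue (ball (fst i) (snd i))
          \<le> (LINT y|lebesgue. indicator (ball (fst i) (snd i)) y * g y)"
        using C(2) by (force simp: K_def)
      moreover have "emeasure lebesgue (ball (fst i) (snd i))
          = ennreal (measure lebesgue (ball (fst i) (snd i)))"
        by (intro emeasure_eq_measure2) (simp add: lmeasurable_ball)
      ultimately show "ennreal c * emeasure lebesgue (ball (fst i) (snd i))
          \<le> emeasure ?\<nu> (ball (fst i) (snd i))"
        using c by (simp add: \<nu>ball ennreal_mult[symmetric] ennreal_leI)
    qed
    also have "\<dots> = emeasure ?\<nu> ?V"
      by (subst emeasure_UN_countable) (use C disj in auto)
    also have "\<dots> \<le> emeasure ?\<nu> U"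
    proof (rule emeasure_mono)
      have "ball (fst i) (snd i) \<subseteq> U" if "i \<in> C" for i
        using subsetD[OF C(2) that] by (auto simp: K_def)
      then show "?V \<subseteq> U" by (rule UN_least)
    qed (use U(1) in simp)
    also have "\<dots> \<le> ennreal c * ennreal e" using U(3) c e by (simp add: ennreal_mult[symmetric])
    finally have V: "emeasure lebesgue ?V \<le> ennreal e"
      using c by (subst (asm) ennreal_mult_le_mult_iff) auto
    have "?V \<in> sets borel" by (intro borel_open open_UN) simp
    then have "?V \<in> sets lebesgue" by (rule sets_completionI_sets[of _ lborel, simplified])
    then have Vm: "?V \<in> lmeasurable"
      using V by (intro fmeasurableI) (auto simp: top_unique order_le_less_trans)
    have "measure lebesgue ?V \<le> e"
      using V e by (simp add: measure_def enn2real_leI)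
    then show "\<exists>T. Bad c \<subseteq> T \<and> T \<in> lmeasurable \<and> measure lebesgue T \<le> e"
    proof (intro exI conjI)
      have N: "Bad c - ?V \<in> null_sets lebesgue" using C(4) by (simp add: negligible_iff_null_sets)
      show "?V \<union> (Bad c - ?V) \<in> lmeasurable"
        by (intro fmeasurable.Un Vm negligible_imp_measurable C(4))
      show "measure lebesgue (?V \<union> (Bad c - ?V)) \<le> e"
        using \<open>measure lebesgue ?V \<le> e\<close> measure_Un_null_set[OF fmeasurableD[OF Vm] N] by linarith
    qed auto
  qed
  have "AE x in lebesgue. \<forall>n. x \<notin> Bad (1 / Suc n)"
    unfolding AE_all_countable
    using negl by (auto intro!: AE_not_in simp: negligible_iff_null_sets)
  then show ?thesis
  proof (rule AE_mp, intro AE_I2 impI allI)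
    fix x and c :: real assume x: "\<forall>n. x \<notin> Bad (1 / Suc n)" "x \<in> F" "c > 0"
    obtain n where n: "1 / Suc n < c" using nat_approx_posE[OF x(3)] by auto
    have "\<not> (\<forall>d>0. \<exists>r>0. r < d \<and>
      1 / Suc n * measure lebesgue (ball x r) < (LINT y|lebesgue. indicator (ball x r) y * g y))"
      using x(1)[rule_format, of n] x(2) unfolding Bad_def by simp
    then obtain d where d: "d > 0" and *: "\<And>r. r > 0 \<Longrightarrow> r < d \<Longrightarrow>
      (LINT y|lebesgue. indicator (ball x r) y * g y) \<le> 1 / Suc n * measure lebesgue (ball x r)"
      unfolding not_all not_imp by (metis linorder_not_le)
    have "1 / Suc n * measure lebesgue (ball x r) \<le> c * measure lebesgue (ball x r)" for r
      using n by (intro mult_right_mono) auto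
    with * have "(LINT y|lebesgue. indicator (ball x r) y * g y) \<le> c * measure lebesgue (ball x r)"
      if "0 < r" "r < d" for r
      using that order_trans by blast
    then show "\<forall>\<^sub>F r in at_right 0.
      (LINT y|lebesgue. indicator (ball x r) y * g y) \<le> c * measure lebesgue (ball x r)"
      unfolding eventually_at_right_field using d by blast
  qed
qed

text \<open>
  For rational \<open>a\<close> with \<open>f x \<le> a\<close> the average of \<open>f\<close> is at most \<open>a\<close> plus the average of
  \<open>max 0 (f - a)\<close>, which vanishes on \<open>{f \<le> a}\<close> and to which the preceding lemma applies. For
  negative \<open>a\<close> this function need not be integrable, hence the truncation to balls around the origin.
\<close>

lemma ball_averages_eventually_less:
  fixes f :: "'a::euclidean_space \<Rightarrow> real"
  assumes f: "integrable lebesgue f"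
  shows "AE x in lebesgue. \<forall>y>f x. \<forall>\<^sub>F r in at_right 0.
    (LINT z|lebesgue. indicator (ball x r) z * f z) / measure lebesgue (ball x r) < y"
proof -
  have [measurable]: "f \<in> borel_measurable lebesgue" using f by simp
  define O' where "O' n = (ball 0 (real n) :: 'a set)" for n
  define F where "F a n = {x \<in> O' n. f x \<le> a}" for a n
  define h where "h a n = (\<lambda>x. indicator (O' n) x * max 0 (f x - a))" for a n
  have [measurable]: "O' n \<in> sets lebesgue" for n by (simp add: O'_def)
  have const: "integrable lebesgue (\<lambda>x. indicator (ball c r) x * (a::real))" for a r and c :: 'a
    by (intro integrable_mult_left integrable_real_indicator) (auto simp: emeasure_lborel_ball_finite[unfolded infinity_ennreal_def])
  have fi: "integrable lebesgue (\<lambda>x. indicator (ball c r) x * f x)" for r c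
    using integrable_mult_indicator[OF _ f, of "ball c r"] by simp
  have h: "integrable lebesgue (h a n)" for a n
  proof -
    have "integrable lebesgue (\<lambda>x. max 0 (indicator (O' n) x * f x - indicator (O' n) x * a))"
      unfolding O'_def by (intro integrable_max Bochner_Integration.integrable_diff const fi) auto
    also have "(\<lambda>x. max 0 (indicator (O' n) x * f x - indicator (O' n) x * a)) = h a n"
      by (auto simp: h_def indicator_def)
    finally show ?thesis .
  qed
  have "AE x in lebesgue. \<forall>a\<in>\<rat>. \<forall>n. x \<in> F a n \<longrightarrow> (\<forall>c>0. \<forall>\<^sub>F r in at_right 0.
      (LINT y|lebesgue. indicator (ball x r) y * h a n y) \<le> c * measure lebesgue (ball x r))"
    unfolding AE_ball_countable[OF countable_rat] AE_all_countable
    by (intro ballI allI small_ball_averages_of_vanishing h)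
       (auto simp: h_def F_def)
  then show ?thesis
  proof (rule AE_mp, intro AE_I2 impI allI)
    fix x y assume *: "\<forall>a\<in>\<rat>. \<forall>n. x \<in> F a n \<longrightarrow> (\<forall>c>0. \<forall>\<^sub>F r in at_right 0.
      (LINT y|lebesgue. indicator (ball x r) y * h a n y) \<le> c * measure lebesgue (ball x r))"
      and y: "f x < y"
    obtain a where a: "a \<in> \<rat>" "f x < a" "a < y" using Rats_dense_in_real[OF y] by auto
    obtain n where n: "norm x < real n" using reals_Archimedean2 by blast
    have x: "x \<in> F a n" using n a by (auto simp: F_def O'_def)
    obtain k where k: "k > 0" "ball x k \<subseteq> O' n"
      using n by (metis O'_def mem_ball_0 open_ball openE)
    have ev: "\<forall>\<^sub>F r in at_right 0. 0 < r \<and> r < k"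
      using k by (auto simp: eventually_at_right_field)
    have "(y - a) / 2 > 0" using a by simp
    then have "\<forall>\<^sub>F r in at_right 0.
      (LINT y|lebesgue. indicator (ball x r) y * h a n y) \<le> (y - a) / 2 * measure lebesgue (ball x r)"
      using * x a by blast
    with ev show "\<forall>\<^sub>F r in at_right 0.
      (LINT z|lebesgue. indicator (ball x r) z * f z) / measure lebesgue (ball x r) < y"
    proof eventually_elim
      case (elim r)
      have pos: "measure lebesgue (ball x r) > 0" using content_ball_pos elim by auto
      have sub: "ball x r \<subseteq> O' n" using elim k subset_ball[of r k x] by force
      have "(LINT z|lebesgue. indicator (ball x r) z * f z)
          \<le> (LINT z|lebesgue. indicator (ball x r) z * h a n z + indicator (ball x r) z * a)"
      proof (intro integral_mono Bochner_Integration.integrable_add const fi)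
        show "integrable lebesgue (\<lambda>z. indicator (ball x r) z * h a n z)"
          using integrable_mult_indicator[OF _ h, of "ball x r"] by simp
      qed (use sub in \<open>auto simp: h_def indicator_def\<close>)
      also have "\<dots> = (LINT z|lebesgue. indicator (ball x r) z * h a n z) + measure lebesgue (ball x r) * a"
        using integrable_mult_indicator[OF _ h, of "ball x r"] const by simp
      also have "\<dots> \<le> (y - a) / 2 * measure lebesgue (ball x r) + measure lebesgue (ball x r) * a"
        using elim by simp
      also have "\<dots> < y * measure lebesgue (ball x r)"
        using mult_strict_right_mono[OF a(3) pos] by (simp add: field_simps)
      finally show ?case using pos by (simp add: field_simps)
    qed
  qed
qed

lemma measure_small_ball_tendsto_0:
  "((\<lambda>r. measure lebesgue (ball (x::'a::euclidean_space) r)) \<longlongrightarrow> 0) (at_right 0)"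
proof -
  let ?c = "measure lebesgue (ball (0::'a) 1)"
  have "((\<lambda>r::real. r ^ DIM('a) * ?c) \<longlongrightarrow> 0 ^ DIM('a) * ?c) (at_right 0)"
    by (intro tendsto_intros)
  then have "((\<lambda>r::real. r ^ DIM('a) * ?c) \<longlongrightarrow> 0) (at_right 0)" by (simp add: power_0_left)
  moreover have "\<forall>\<^sub>F r in at_right 0. r ^ DIM('a) * ?c = measure lebesgue (ball x r)"
    unfolding eventually_at_right_field
    using content_ball_conv_unit_ball[of _ x] by (intro exI[of _ 1]) auto
  ultimately show ?thesis by (rule Lim_transform_eventually)
qed

theorem Lebesgue_differentiation_balls:
  fixes f :: "'a::euclidean_space \<Rightarrow> real"
  assumes f: "integrable lebesgue f"
  shows "AE x in lebesgue.
    ((\<lambda>r. (LINT z|lebesgue. indicator (ball x r) z * f z) / measure lebesgue (ball x r)) \<longlongrightarrow> f x)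
      (at_right 0)"
  using ball_averages_eventually_less[OF f] ball_averages_eventually_less[OF integrable_minus[OF f]]
proof eventually_elim
  case (elim x)
  show ?case
  proof (rule order_tendstoI)
    fix y assume "y < f x"
    then have "- f x < - y" by simp
    from elim(2)[rule_format, OF this]
    show "\<forall>\<^sub>F r in at_right 0. y < (LINT z|lebesgue. indicator (ball x r) z * f z) / measure lebesgue (ball x r)"
      by simp
  qed (use elim(1) in auto)
qed

section \<open>Elementary inequalities and square integrable functions\<close>

lemma abs_powr_2: "\<bar>a\<bar> powr 2 = (a::real)\<^sup>2"
  by (cases "a = 0") (simp_all add: powr_numeral)

text \<open>
  Integrated over a set of measure \<open>m\<close> and with \<open>l\<close> chosen to balance the two terms, this yields the
  special case of Hoelder's inequality that bounds \<open>\<integral> \<bar>f\<bar>\<close> by a multiple of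
  \<open>\<parallel>f\<parallel>\<^sub>q m\<^bsup>1 - 1/q\<^esup>\<close>.
\<close>

lemma abs_le_threshold_plus_power:
  fixes a l q :: real
  assumes "0 < l" "1 \<le> q"
  shows "\<bar>a\<bar> \<le> l + l powr (1 - q) * \<bar>a\<bar> powr q"
proof (cases "\<bar>a\<bar> \<le> l")
  case False
  then have "\<bar>a\<bar> powr (1 - q) \<le> l powr (1 - q)"
    using assms by (intro powr_mono2') auto
  then have "\<bar>a\<bar> powr (1 - q) * \<bar>a\<bar> powr q \<le> l powr (1 - q) * \<bar>a\<bar> powr q"
    by (intro mult_right_mono) auto
  moreover have "\<bar>a\<bar> powr (1 - q) * \<bar>a\<bar> powr q = \<bar>a\<bar>"
    using False assms by (simp flip: powr_add)
  ultimately show ?thesis using assms by linarith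
qed (simp add: add_increasing2)

lemma integrable_mult_of_squares:
  fixes f g :: "'a \<Rightarrow> real"
  assumes [measurable]: "f \<in> borel_measurable M" "g \<in> borel_measurable M"
    and "integrable M (\<lambda>x. (f x)\<^sup>2)" "integrable M (\<lambda>x. (g x)\<^sup>2)"
  shows "integrable M (\<lambda>x. f x * g x)"
proof (rule Bochner_Integration.integrable_bound[OF Bochner_Integration.integrable_add[OF assms(3,4)]])
  have "\<bar>a * b\<bar> \<le> a\<^sup>2 + b\<^sup>2" for a b :: real
  proof -
    have "0 \<le> (\<bar>a\<bar> - \<bar>b\<bar>)\<^sup>2" by simp
    then have "2 * (\<bar>a\<bar> * \<bar>b\<bar>) \<le> a\<^sup>2 + b\<^sup>2" by (simp add: power2_diff)
    moreover have "0 \<le> \<bar>a\<bar> * \<bar>b\<bar>" by simp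
    ultimately show ?thesis unfolding abs_mult by linarith
  qed
  then show "AE x in M. norm (f x * g x) \<le> norm ((f x)\<^sup>2 + (g x)\<^sup>2)" by simp
qed simp

lemma norm_midpoint_sq:
  fixes a b :: "'b::real_normed_vector"
  shows "(norm ((1/2) *\<^sub>R a + (1/2) *\<^sub>R b))\<^sup>2 \<le> (1/2) * (norm a)\<^sup>2 + (1/2) * (norm b)\<^sup>2"
proof -
  have "norm ((1/2) *\<^sub>R a + (1/2) *\<^sub>R b) \<le> (1/2) * norm a + (1/2) * norm b"
    by (rule norm_triangle_le) simp
  then have "(norm ((1/2) *\<^sub>R a + (1/2) *\<^sub>R b))\<^sup>2 \<le> ((1/2) * norm a + (1/2) * norm b)\<^sup>2"
    by (intro power_mono) auto
  also have "\<dots> = (1/2) * (norm a)\<^sup>2 + (1/2) * (norm b)\<^sup>2 - ((1/2) * norm a - (1/2) * norm b)\<^sup>2"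
    by (simp add: power2_eq_square algebra_simps)
  also have "\<dots> \<le> (1/2) * (norm a)\<^sup>2 + (1/2) * (norm b)\<^sup>2" by simp
  finally show ?thesis .
qed

text \<open>
  A substitute for weak compactness. If \<open>d\<^sub>n\<close> is the infimum of \<open>\<integral> u\<^sup>2\<close> over \<open>K\<^sub>n\<close>, then \<open>d\<close> is
  increasing and bounded, hence convergent. Take \<open>u\<^sub>n \<in> K\<^sub>n\<close> with \<open>\<integral> u\<^sub>n\<^sup>2\<close> close to \<open>d\<^sub>n\<close>. For
  \<open>i \<le> j\<close> the midpoint of \<open>u\<^sub>i\<close> and \<open>u\<^sub>j\<close> lies in \<open>K\<^sub>i\<close>, and the parallelogram law bounds
  \<open>\<integral> (u\<^sub>i - u\<^sub>j)\<^sup>2\<close> by about \<open>2 d\<^sub>i + 2 d\<^sub>j - 4 d\<^sub>i\<close>.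
\<close>

lemma near_minimal_norm_sequence_Cauchy:
  fixes K :: "nat \<Rightarrow> ('a \<Rightarrow> real) set"
  assumes meas: "\<And>n u. u \<in> K n \<Longrightarrow> u \<in> borel_measurable M"
    and sq: "\<And>n u. u \<in> K n \<Longrightarrow> integrable M (\<lambda>x. (u x)\<^sup>2)"
    and bound: "\<And>n u. u \<in> K n \<Longrightarrow> (LINT x|M. (u x)\<^sup>2) \<le> R"
    and ne: "\<And>n. K n \<noteq> {}"
    and dec: "\<And>m n. m \<le> n \<Longrightarrow> K n \<subseteq> K m"
    and mid: "\<And>n u v. u \<in> K n \<Longrightarrow> v \<in> K n \<Longrightarrow> (\<lambda>x. (1/2) * u x + (1/2) * v x) \<in> K n"
  obtains u where "\<And>n. u n \<in> K n"
    "\<And>e. 0 < e \<Longrightarrow> \<exists>N. \<forall>i\<ge>N. \<forall>j\<ge>N. (LINT x|M. (u i x - u j x)\<^sup>2) < e"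
proof -
  define Q where "Q u = (LINT x|M. (u x)\<^sup>2)" for u :: "'a \<Rightarrow> real"
  define d where "d n = Inf (Q ` K n)" for n
  have Q0: "0 \<le> Q u" for u by (simp add: Q_def)
  have bdd: "bdd_below (Q ` K n)" for n by (rule bdd_belowI[of _ 0]) (auto simp: Q0)
  have dQ: "d n \<le> Q u" if "u \<in> K n" for n u
    unfolding d_def using that by (intro cInf_lower bdd) auto
  have dR: "d n \<le> R" for n
    using ne[of n] dQ[of _ n] bound[of _ n] unfolding Q_def by (meson all_not_in_conv order_trans)
  have inc: "incseq d"
    unfolding d_def by (intro monoI cInf_superset_mono image_mono dec bdd) (use ne in auto)
  obtain L where L: "d \<longlonglongrightarrow> L" "\<And>n. d n \<le> L"
    using incseq_convergent[OF inc] dR by (metis)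
  have "\<exists>u\<in>K n. Q u < d n + 1 / Suc n" for n
    using cInf_lessD[of "Q ` K n" "d n + 1 / Suc n"] ne by (auto simp: d_def)
  then obtain u where u: "\<And>n. u n \<in> K n" "\<And>n. Q (u n) < d n + 1 / Suc n" by metis
  have est: "Q (\<lambda>x. u i x - u j x) \<le> 2 * L - 2 * d i + 4 / Suc i" if ij: "i \<le> j" for i j
  proof -
    have uj: "u j \<in> K i" using u(1) dec[OF ij] by blast
    note int = sq[OF u(1)[of i]] sq[OF uj]
    have [measurable]: "u i \<in> borel_measurable M" "u j \<in> borel_measurable M"
      using u(1) meas by blast+
    have prod: "integrable M (\<lambda>x. u i x * u j x)"
      by (rule integrable_mult_of_squares) (use int in auto)
    have m: "(\<lambda>x. (1/2) * u i x + (1/2) * u j x) \<in> K i" using mid u(1) uj by blast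
    define k where "k = 1 / real (Suc i)"
    have diff: "Q (\<lambda>x. u i x - u j x) = Q (u i) + Q (u j) - 2 * (LINT x|M. u i x * u j x)"
      unfolding Q_def using int prod by (simp add: power2_diff mult.assoc)
    have "4 * Q (\<lambda>x. (1/2) * u i x + (1/2) * u j x)
        = (LINT x|M. 4 * ((1/2) * u i x + (1/2) * u j x)\<^sup>2)"
      by (simp add: Q_def)
    also have "\<dots> = (LINT x|M. (u i x)\<^sup>2 + (u j x)\<^sup>2 + 2 * (u i x * u j x))"
      by (intro Bochner_Integration.integral_cong) (auto simp: power2_eq_square algebra_simps)
    also have "\<dots> = Q (u i) + Q (u j) + 2 * (LINT x|M. u i x * u j x)"
      using int prod by (simp add: Q_def)
    finally have midQ: "Q (u i) + Q (u j) + 2 * (LINT x|M. u i x * u j x) \<ge> 4 * d i"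
      using dQ[OF m] by linarith
    have ui: "Q (u i) \<le> d i + k" using u(2)[of i] by (simp add: k_def)
    have "1 / real (Suc j) \<le> k" unfolding k_def using ij by (simp add: frac_le)
    then have uj: "Q (u j) \<le> L + k" using u(2)[of j] L(2)[of j] by linarith
    have "Q (\<lambda>x. u i x - u j x) \<le> 2 * L - 2 * d i + 4 * k"
      using diff midQ ui uj by linarith
    then show ?thesis by (simp add: k_def)
  qed
  have "(\<lambda>i. 2 * L - 2 * d i + 4 * (1 / Suc i)) \<longlonglongrightarrow> 2 * L - 2 * L + 4 * 0"
    by (intro tendsto_intros L LIMSEQ_Suc[OF lim_1_over_n])
  then have lim: "(\<lambda>i. 2 * L - 2 * d i + 4 / Suc i) \<longlonglongrightarrow> 0" by simp
  show ?thesis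
  proof (rule that[OF u(1)])
    fix e :: real assume "0 < e"
    then obtain N where N: "\<And>i. i \<ge> N \<Longrightarrow> 2 * L - 2 * d i + 4 / Suc i < e"
      using order_tendstoD(2)[OF lim] by (auto simp: eventually_sequentially)
    have sym: "Q (\<lambda>x. u i x - u j x) = Q (\<lambda>x. u j x - u i x)" for i j
      by (simp add: Q_def power2_commute)
    have "Q (\<lambda>x. u i x - u j x) < e" if "i \<ge> N" "j \<ge> N" for i j
    proof (cases "i \<le> j")
      case True
      then show ?thesis using est[OF True] N[OF that(1)] by linarith
    next
      case False
      then have "j \<le> i" by simp
      then show ?thesis using est[of j i] N[OF that(2)] sym[of i j] by linarith
    qed
    then show "\<exists>N. \<forall>i\<ge>N. \<forall>j\<ge>N. (LINT x|M. (u i x - u j x)\<^sup>2) < e"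
      unfolding Q_def by blast
  qed
qed

text \<open>
  On a finite measure space \<open>\<bar>a\<bar> \<le> t + a\<^sup>2 / t\<close> turns an \<open>L\<^sup>2\<close> Cauchy sequence into an \<open>L\<^sup>1\<close> Cauchy
  sequence, for which a convergent subsequence is known to exist.
\<close>

lemma (in finite_measure) L2_Cauchy_AE_convergent_subseq:
  fixes u :: "nat \<Rightarrow> 'a \<Rightarrow> real"
  assumes [measurable]: "\<And>n. u n \<in> borel_measurable M"
    and sq: "\<And>n. integrable M (\<lambda>x. (u n x)\<^sup>2)"
    and Cauchy: "\<And>e. 0 < e \<Longrightarrow> \<exists>N. \<forall>i\<ge>N. \<forall>j\<ge>N. (LINT x|M. (u i x - u j x)\<^sup>2) < e"
  obtains r v where "strict_mono r" "v \<in> borel_measurable M"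
    "AE x in M. (\<lambda>i. u (r i) x) \<longlonglongrightarrow> v x"
proof -
  have int: "integrable M (u n)" for n
    by (rule square_integrable_imp_integrable) (use sq in auto)
  have sqd: "integrable M (\<lambda>x. (u i x - u j x)\<^sup>2)" for i j
    using integrable_mult_of_squares[of "u i" M "u j"] sq
    by (simp add: power2_diff mult.assoc)
  have L1: "\<exists>N. \<forall>i\<ge>N. \<forall>j\<ge>N. (LINT x|M. norm (u i x - u j x)) < e" if e: "e > 0" for e
  proof -
    \<comment> \<open>the summand \<open>1\<close> keeps \<open>m\<close> positive on a null space\<close>
    define m where "m = measure M (space M) + 1"
    have m: "m > 0" by (simp add: m_def add_nonneg_pos)
    define t where "t = e / (2 * m)"
    have t: "t > 0" using e m by (simp add: t_def)
    obtain N where N: "\<And>i j. i \<ge> N \<Longrightarrow> j \<ge> N \<Longrightarrow> (LINT x|M. (u i x - u j x)\<^sup>2) < t * (e / 2)"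
      using Cauchy[of "t * (e / 2)"] t e by auto
    have pt: "\<bar>a\<bar> \<le> t + a\<^sup>2 / t" for a :: real
    proof (cases "\<bar>a\<bar> \<le> t")
      case False
      then have "t * \<bar>a\<bar> \<le> \<bar>a\<bar> * \<bar>a\<bar>" by (intro mult_right_mono) auto
      then have "\<bar>a\<bar> \<le> a\<^sup>2 / t" using t by (simp add: field_simps power2_eq_square)
      then show ?thesis using t by linarith
    qed (use t in \<open>simp add: add_increasing2\<close>)
    have "(LINT x|M. norm (u i x - u j x)) < e" if ij: "i \<ge> N" "j \<ge> N" for i j
    proof -
      have "(LINT x|M. norm (u i x - u j x)) \<le> (LINT x|M. t + (u i x - u j x)\<^sup>2 / t)"
        using int sqd pt by (intro integral_mono) auto
      also have "\<dots> = t * measure M (space M) + (LINT x|M. (u i x - u j x)\<^sup>2) / t"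
        using sqd by simp
      also have "\<dots> \<le> t * m + (LINT x|M. (u i x - u j x)\<^sup>2) / t"
        using t by (simp add: m_def)
      also have "(LINT x|M. (u i x - u j x)\<^sup>2) / t < e / 2"
        using N[OF ij] t by (simp add: field_simps)
      also have "t * m + e / 2 = e" using m by (simp add: t_def)
      finally show ?thesis by simp
    qed
    then show ?thesis by blast
  qed
  obtain r where r: "strict_mono r" "AE x in M. Cauchy (\<lambda>i. u (r i) x)"
    using cauchy_L1_AE_cauchy_subseq[of M u, OF int L1] by blast
  define v where "v x = lim (\<lambda>i. u (r i) x)" for x
  show ?thesis
  proof (rule that[OF r(1)])
    show "v \<in> borel_measurable M" unfolding v_def by measurable
    show "AE x in M. (\<lambda>i. u (r i) x) \<longlonglongrightarrow> v x"
      using r(2) by eventually_elim (simp add: v_def Cauchy_convergent_iff convergent_LIMSEQ_iff)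
  qed
qed

section \<open>The integrand and its Hamiltonian\<close>

locale convex_integrand =
  fixes g :: "real \<Rightarrow> ereal"
  assumes g_convex: "ereal_convex g" and g_lsc: "lower_semicontinuous g"
    and g_nonneg: "\<And>u. 0 \<le> g u" and g_zero_iff: "\<And>u. g u = 0 \<longleftrightarrow> u = 0"
    and g_bounded_dom: "bounded (ereal_dom g)"
begin

lemma g_0 [simp]: "g 0 = 0" by (simp add: g_zero_iff)

lemma eventually_less_g:
  assumes "y < g x" shows "\<forall>\<^sub>F z in nhds x. y < g z"
  using g_lsc assms unfolding lower_semicontinuous_def le_Liminf_iff
  by (auto simp: eventually_nhds_conv_at)

lemma g_measurable [measurable]: "g \<in> borel_measurable borel"
  unfolding borel_measurable_ereal_iff_Ioi
proof (intro allI)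
  fix a
  have "open (g -` {a<..})"
    unfolding open_subopen[of "g -` {a<..}"]
    using eventually_less_g[of a] by (fastforce simp: eventually_nhds)
  then show "g -` {a<..} \<inter> space borel \<in> sets borel" by simp
qed

text \<open>
  The real-valued version of \<open>g\<close>; it is \<open>0\<close> where \<open>g\<close> is infinite, so statements about \<open>h\<close> are
  meaningful together with finiteness of \<open>g\<close>.
\<close>

definition h :: "real \<Rightarrow> real" where "h u = real_of_ereal (g u)"

lemma h_measurable [measurable]: "h \<in> borel_measurable borel"
  unfolding h_def by measurable

lemma h_0 [simp]: "h 0 = 0" by (simp add: h_def)

lemma h_nonneg: "0 \<le> h u" using g_nonneg[of u] by (simp add: h_def real_of_ereal_pos)

lemma g_eq_h: "g u < \<infinity> \<Longrightarrow> g u = ereal (h u)"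
  using g_nonneg[of u] by (cases "g u") (auto simp: h_def)

definition R :: real where "R = (SOME r. 0 < r \<and> (\<forall>u\<in>ereal_dom g. norm u \<le> r))"

lemma R_pos: "0 < R" and abs_le_R: "g u < \<infinity> \<Longrightarrow> \<bar>u\<bar> \<le> R"
proof -
  have "0 < R \<and> (\<forall>u\<in>ereal_dom g. norm u \<le> R)"
    unfolding R_def by (rule someI_ex) (use g_bounded_dom bounded_pos in blast)
  then show "0 < R" and "g u < \<infinity> \<Longrightarrow> \<bar>u\<bar> \<le> R" by (auto simp: ereal_dom_def)
qed

lemma h_convex:
  assumes "g u < \<infinity>" "g v < \<infinity>" "0 \<le> t" "t \<le> 1"
  shows "g ((1 - t) * u + t * v) < \<infinity>"
    and "h ((1 - t) * u + t * v) \<le> (1 - t) * h u + t * h v"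
proof -
  have "g ((1 - t) *\<^sub>R u + t *\<^sub>R v) \<le> ereal (1 - t) * g u + ereal t * g v"
    using g_convex assms(3,4) unfolding ereal_convex_def by auto
  then have le: "g ((1 - t) * u + t * v) \<le> ereal ((1 - t) * h u + t * h v)"
    using g_eq_h[OF assms(1)] g_eq_h[OF assms(2)] by simp
  then show fin: "g ((1 - t) * u + t * v) < \<infinity>" by (auto simp: less_top[symmetric] top_ereal_def)
  show "h ((1 - t) * u + t * v) \<le> (1 - t) * h u + t * h v"
    using le g_eq_h[OF fin] by simp
qed

text \<open>
  If the infimum were not attained, the open sets \<open>{u. \<phi> v < \<phi> u}\<close> with \<open>v\<close> in the compact
  interval \<open>{-R..R}\<close> would cover it, since it contains the domain of \<open>g\<close>.
  A finite set of such \<open>v\<close> already suffices, and the one among them with the smallest value is not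
  covered.
\<close>

lemma linear_plus_g_attains_min: "\<exists>u. \<forall>v. ereal (p * u) + g u \<le> ereal (p * v) + g v"
proof (rule ccontr)
  let ?\<phi> = "\<lambda>u. ereal (p * u) + g u"
  assume "\<not> ?thesis"
  then have no_min: "\<And>u. \<exists>v. ?\<phi> v < ?\<phi> u" by (simp add: not_le)
  have op: "open {u. ?\<phi> v < ?\<phi> u}" for v
  proof (subst open_subopen, safe)
    fix u assume lt: "?\<phi> v < ?\<phi> u"
    then have "g v < \<infinity>" by (cases "g v") auto
    then obtain c where c: "?\<phi> v = ereal c" using g_eq_h by (metis plus_ereal.simps(1))
    have "ereal (c - p * u) < g u" using lt c by (cases "g u") auto
    then obtain b where b: "ereal (c - p * u) < ereal b" "ereal b < g u"
      using ereal_dense2 by blast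
    have "isCont (\<lambda>z. p * z) u" by (intro continuous_intros)
    then have "((\<lambda>z. p * z) \<longlongrightarrow> p * u) (nhds u)" by (simp add: isCont_def flip: tendsto_at_iff_tendsto_nhds)
    then have "\<forall>\<^sub>F z in nhds u. c - b < p * z"
      using b(1) by (intro order_tendstoD(1)) auto
    then have "\<forall>\<^sub>F z in nhds u. ?\<phi> v < ?\<phi> z"
      using eventually_less_g[OF b(2)]
    proof eventually_elim
      case (elim z)
      then show ?case unfolding c by (cases "g z") auto
    qed
    then show "\<exists>T. open T \<and> u \<in> T \<and> T \<subseteq> {u. ?\<phi> v < ?\<phi> u}"
      by (auto simp: eventually_nhds)
  qed
  have "{-R..R} \<subseteq> (\<Union>v\<in>{-R..R}. {u. ?\<phi> v < ?\<phi> u})"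
  proof
    fix u assume "u \<in> {-R..R}"
    obtain v where v: "?\<phi> v < ?\<phi> u" using no_min by blast
    then have "g v < \<infinity>" by (cases "g v") auto
    then have "v \<in> {-R..R}" using abs_le_R[of v] by auto
    then show "u \<in> (\<Union>v\<in>{-R..R}. {u. ?\<phi> v < ?\<phi> u})" using v by blast
  qed
  then obtain T where T: "T \<subseteq> {-R..R}" "finite T" "{-R..R} \<subseteq> (\<Union>v\<in>T. {u. ?\<phi> v < ?\<phi> u})"
    using compactE_image[OF compact_Icc, of "{-R..R}" "\<lambda>v. {u. ?\<phi> v < ?\<phi> u}" "-R" R] op by auto
  have "T \<noteq> {}" using T(3) R_pos by auto
  then obtain v where v: "v \<in> T" "\<And>w. w \<in> T \<Longrightarrow> ?\<phi> v \<le> ?\<phi> w"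
    using arg_min_if_finite(1)[OF T(2), of ?\<phi>] arg_min_least[OF T(2), of _ ?\<phi>] by metis
  obtain w where "w \<in> T" "?\<phi> w < ?\<phi> v" using T(1,3) v(1) by blast
  then show False using v(2) by (simp add: leD)
qed

text \<open>
  A selection from the minimizers in the definition of the Hamiltonian. Any choice is as good as any
  other, because all of them are antimonotone in \<open>p\<close> and therefore measurable.
\<close>

definition sel :: "real \<Rightarrow> real" where
  "sel p = (SOME u. \<forall>v. ereal (p * u) + g u \<le> ereal (p * v) + g v)"

definition H :: "real \<Rightarrow> real" where "H p = p * sel p + h (sel p)"

lemma sel_least: "ereal (p * sel p) + g (sel p) \<le> ereal (p * v) + g v"
  unfolding sel_def by (rule someI2_ex[OF linear_plus_g_attains_min]) blast

lemma g_sel: "g (sel p) < \<infinity>"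
  using sel_least[of p 0] by (cases "g (sel p)") auto

lemma abs_sel: "\<bar>sel p\<bar> \<le> R" by (rule abs_le_R[OF g_sel])

lemma hamiltonian_eq: "hamiltonian g p = ereal (H p)"
  unfolding hamiltonian_def
proof (rule Least_equality)
  show "ereal (H p) \<in> range (\<lambda>u. ereal (p * u) + g u)"
    using g_eq_h[OF g_sel[of p]] by (intro image_eqI[of _ _ "sel p"]) (auto simp: H_def)
  show "ereal (H p) \<le> y" if "y \<in> range (\<lambda>u. ereal (p * u) + g u)" for y
    using that sel_least[of p] g_eq_h[OF g_sel[of p]] by (auto simp: H_def)
qed

lemma H_le: "g v < \<infinity> \<Longrightarrow> H p \<le> p * v + h v"
  using sel_least[of p v] g_eq_h[OF g_sel[of p]] g_eq_h[of v] by (simp add: H_def)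

text \<open>
  Adding the two inequalities that express minimality at \<open>p\<close> and at \<open>r\<close> gives
  \<open>(p - r) (sel r - sel p) \<ge> 0\<close>.
\<close>

lemma antimono_sel: "antimono sel"
proof (rule antimonoI)
  fix p r :: real assume "p \<le> r"
  show "sel r \<le> sel p"
  proof (rule ccontr)
    assume "\<not> sel r \<le> sel p"
    then have lt: "0 < sel r - sel p" by simp
    have "0 \<le> (p - r) * (sel r - sel p)"
      using H_le[OF g_sel, of p r] H_le[OF g_sel, of r p] by (simp add: H_def algebra_simps)
    then have "p = r" using lt \<open>p \<le> r\<close> by (auto simp: zero_le_mult_iff)
    then show False using lt by simp
  qed
qed

lemma sel_measurable [measurable]: "sel \<in> borel_measurable borel"
proof -
  have "mono (\<lambda>p. - sel p)" using antimono_sel by (auto simp: monotone_def)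
  then have "(\<lambda>p. - sel p) \<in> borel_measurable borel" by (rule borel_measurable_mono)
  then show ?thesis by simp
qed

lemma H_measurable [measurable]: "H \<in> borel_measurable borel"
  unfolding H_def by measurable

lemma h_sel_le: "h (sel p) \<le> R * \<bar>p\<bar>"
proof -
  have "\<bar>p * sel p\<bar> \<le> R * \<bar>p\<bar>" 
    using mult_right_mono[OF abs_sel[of p], of "\<bar>p\<bar>"] by (simp add: abs_mult mult.commute)
  then show ?thesis using H_le[of 0 p] by (simp add: H_def)
qed

lemma abs_H_le: "\<bar>H p\<bar> \<le> R * \<bar>p\<bar>"
proof -
  have "\<bar>p * sel p\<bar> \<le> R * \<bar>p\<bar>" 
    using mult_right_mono[OF abs_sel[of p], of "\<bar>p\<bar>"] by (simp add: abs_mult mult.commute)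
  then show ?thesis using H_le[of 0 p] h_nonneg[of "sel p"] by (simp add: H_def)
qed

end

section \<open>The control problem and its admissible controls\<close>

locale control_problem = convex_integrand g for g +
  fixes \<Omega> :: "'a::euclidean_space set"
    and S :: "('a \<Rightarrow> real) \<Rightarrow> 'y::real_inner"
    and Sadj :: "'y \<Rightarrow> 'a \<Rightarrow> real"
    and yd :: 'y and \<beta> :: "'a \<Rightarrow> real" and q :: real
  assumes \<Omega>_sets: "\<Omega> \<in> sets lebesgue" and \<Omega>_finite: "emeasure lebesgue \<Omega> < \<infinity>"
    and S_bounded_linear: "bounded_linear_from_L2 \<Omega> S"
    and S_adjoint: "is_L2_adjoint \<Omega> S Sadj"
    and q_gt: "2 < q" and Sadj_bounded_linear: "bounded_linear_to_Lp q \<Omega> Sadj"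
    and \<beta>_integrable: "integrable (lebesgue_on \<Omega>) \<beta>"
begin

abbreviation "M \<equiv> lebesgue_on \<Omega>"

sublocale finite_measure M
  by (rule finite_measureI) (use \<Omega>_sets \<Omega>_finite in \<open>simp add: emeasure_restrict_space space_restrict_space\<close>)

lemma indicator_measurable_M: "A \<in> sets lebesgue \<Longrightarrow> indicat_real A \<in> borel_measurable M"
  by (intro measurable_restrict_space1) simp

lemma \<beta>_measurable [measurable]: "\<beta> \<in> borel_measurable M" using \<beta>_integrable by simp

lemma indicator_mult_integrable:
  assumes "A \<in> sets lebesgue" "integrable M f"
  shows "integrable M (\<lambda>x. indicator A x * (f x :: real))"
proof (rule Bochner_Integration.integrable_bound[OF assms(2)])
  have [measurable]: "f \<in> borel_measurable M" using assms(2) by simp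
  note [measurable] = indicator_measurable_M[OF assms(1)]
  show "(\<lambda>x. indicator A x * f x) \<in> borel_measurable M" by measurable
qed (auto simp: indicator_def)

lemma L2_iff: "u \<in> Lp_space 2 \<Omega> \<longleftrightarrow> u \<in> borel_measurable M \<and> integrable M (\<lambda>x. (u x)\<^sup>2)"
  by (simp add: Lp_space_def abs_powr_2)

lemma Lp_norm_2: "Lp_norm 2 \<Omega> u = sqrt (LINT x|M. (u x)\<^sup>2)"
  by (simp add: Lp_norm_def abs_powr_2 powr_half_sqrt)

lemma L2_add: "u \<in> Lp_space 2 \<Omega> \<Longrightarrow> v \<in> Lp_space 2 \<Omega> \<Longrightarrow> (\<lambda>x. u x + v x) \<in> Lp_space 2 \<Omega>"
  using integrable_mult_of_squares[of u M v] by (auto simp: L2_iff power2_sum mult.assoc)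

lemma L2_cmult: "u \<in> Lp_space 2 \<Omega> \<Longrightarrow> (\<lambda>x. c * u x) \<in> Lp_space 2 \<Omega>"
  by (auto simp: L2_iff power_mult_distrib)

lemma L2_diff: "u \<in> Lp_space 2 \<Omega> \<Longrightarrow> v \<in> Lp_space 2 \<Omega> \<Longrightarrow> (\<lambda>x. u x - v x) \<in> Lp_space 2 \<Omega>"
  using L2_add[of u "\<lambda>x. -1 * v x"] L2_cmult[of v "-1"] by simp

lemma L2_indicator:
  assumes "A \<in> sets lebesgue" "u \<in> Lp_space 2 \<Omega>"
  shows "(\<lambda>x. indicator A x * u x) \<in> Lp_space 2 \<Omega>"
  unfolding L2_iff
proof
  note [measurable] = indicator_measurable_M[OF assms(1)]
  have [measurable]: "u \<in> borel_measurable M" and sq: "integrable M (\<lambda>x. (u x)\<^sup>2)"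
    using assms(2) by (auto simp: L2_iff)
  show "(\<lambda>x. indicator A x * u x) \<in> borel_measurable M" by measurable
  have "(\<lambda>x. (indicator A x * u x)\<^sup>2) = (\<lambda>x. indicator A x * (u x)\<^sup>2)"
    by (auto simp: indicator_def)
  then show "integrable M (\<lambda>x. (indicator A x * u x)\<^sup>2)"
    using indicator_mult_integrable[OF assms(1) sq] by simp
qed

lemma L2_bounded:
  assumes "u \<in> borel_measurable M" "AE x in M. \<bar>u x\<bar> \<le> r"
  shows "u \<in> Lp_space 2 \<Omega>"
  unfolding L2_iff
proof
  show "integrable M (\<lambda>x. (u x)\<^sup>2)"
  proof (rule integrable_const_bound[of _ "r\<^sup>2"])
    show "AE x in M. norm ((u x)\<^sup>2) \<le> r\<^sup>2"
      using assms(2)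
    proof eventually_elim
      case (elim x)
      then show ?case using power_mono[of "\<bar>u x\<bar>" r 2] by simp
    qed
  qed (use assms(1) in measurable)
qed (rule assms(1))

lemma L2_mult_integrable:
  "u \<in> Lp_space 2 \<Omega> \<Longrightarrow> v \<in> Lp_space 2 \<Omega> \<Longrightarrow> integrable M (\<lambda>x. u x * v x)"
  using integrable_mult_of_squares[of u M v] by (simp add: L2_iff)

lemma L2_integrable: "u \<in> Lp_space 2 \<Omega> \<Longrightarrow> integrable M u"
  unfolding L2_iff by (elim conjE) (rule square_integrable_imp_integrable)

lemma S_add: "u \<in> Lp_space 2 \<Omega> \<Longrightarrow> v \<in> Lp_space 2 \<Omega> \<Longrightarrow> S (\<lambda>x. u x + v x) = S u + S v"
  and S_cmult: "u \<in> Lp_space 2 \<Omega> \<Longrightarrow> S (\<lambda>x. c * u x) = c *\<^sub>R S u"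
  using S_bounded_linear by (auto simp: bounded_linear_from_L2_def)

lemma S_diff: "u \<in> Lp_space 2 \<Omega> \<Longrightarrow> v \<in> Lp_space 2 \<Omega> \<Longrightarrow> S (\<lambda>x. u x - v x) = S u - S v"
  using S_add[of u "\<lambda>x. -1 * v x"] L2_cmult[of v "-1"] S_cmult[of v "-1"] by simp

lemma S_norm_bound:
  obtains C where "\<And>u. u \<in> Lp_space 2 \<Omega> \<Longrightarrow> norm (S u) \<le> C * sqrt (LINT x|M. (u x)\<^sup>2)"
proof -
  obtain C where "\<forall>u\<in>Lp_space 2 \<Omega>. norm (S u) \<le> C * sqrt (LINT x|M. (u x)\<^sup>2)"
    using S_bounded_linear unfolding bounded_linear_from_L2_def Lp_norm_2 by blast
  then show ?thesis by (intro that) blast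
qed

lemma S_cong_AE:
  assumes "u \<in> Lp_space 2 \<Omega>" "v \<in> Lp_space 2 \<Omega>" "AE x in M. u x = v x"
  shows "S u = S v"
proof -
  obtain C where C: "\<And>u. u \<in> Lp_space 2 \<Omega> \<Longrightarrow> norm (S u) \<le> C * sqrt (LINT x|M. (u x)\<^sup>2)"
    using S_norm_bound by blast
  have "(LINT x|M. (u x - v x)\<^sup>2) = (LINT x|M. 0)"
    using assms by (intro integral_cong_AE) (auto simp: L2_iff)
  then have "norm (S (\<lambda>x. u x - v x)) \<le> 0"
    using C[OF L2_diff[OF assms(1,2)]] by simp
  then show ?thesis using S_diff[OF assms(1,2)] by simp
qed

lemma S_tendsto:
  assumes "\<And>n. u n \<in> Lp_space 2 \<Omega>" "v \<in> Lp_space 2 \<Omega>"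
    and "(\<lambda>n. LINT x|M. (u n x - v x)\<^sup>2) \<longlonglongrightarrow> 0"
  shows "(\<lambda>n. S (u n)) \<longlonglongrightarrow> S v"
proof -
  obtain C where C: "\<And>u. u \<in> Lp_space 2 \<Omega> \<Longrightarrow> norm (S u) \<le> C * sqrt (LINT x|M. (u x)\<^sup>2)"
    using S_norm_bound by blast
  have "(\<lambda>n. C * sqrt (LINT x|M. (u n x - v x)\<^sup>2)) \<longlonglongrightarrow> C * sqrt 0"
    by (intro tendsto_intros assms)
  then have lim: "(\<lambda>n. C * sqrt (LINT x|M. (u n x - v x)\<^sup>2)) \<longlonglongrightarrow> 0" by simp
  have "(\<lambda>n. S (u n) - S v) \<longlonglongrightarrow> 0"
  proof (rule Lim_null_comparison[OF _ lim])
    show "\<forall>\<^sub>F n in sequentially. norm (S (u n) - S v) \<le> C * sqrt (LINT x|M. (u n x - v x)\<^sup>2)"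
      using C[OF L2_diff[OF assms(1,2)]] unfolding S_diff[OF assms(1,2)] by simp
  qed
  then show ?thesis by (rule LIM_zero_cancel)
qed

lemma Sadj_L2: "Sadj y \<in> Lp_space 2 \<Omega>"
  and S_inner: "u \<in> Lp_space 2 \<Omega> \<Longrightarrow> S u \<bullet> y = (LINT x|M. u x * Sadj y x)"
  using S_adjoint by (auto simp: is_L2_adjoint_def)

text \<open>
  The controls of finite cost. Boundedness of the domain of \<open>g\<close> makes them essentially bounded, so
  square integrability holds automatically.
\<close>

definition admissible :: "('a \<Rightarrow> real) \<Rightarrow> bool" where
  "admissible u \<longleftrightarrow> u \<in> borel_measurable M \<and> (AE x in M. g (u x) < \<infinity>) \<and> integrable M (\<lambda>x. h (u x))"

definition real_cost :: "('a \<Rightarrow> real) \<Rightarrow> 'a set \<Rightarrow> real" where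
  "real_cost u A = 1 / 2 * (norm (S (\<lambda>x. indicator A x * u x) - yd))\<^sup>2
     + (LINT x|M. h (u x)) + (LINT x|M. indicator A x * \<beta> x)"

lemma admissible_0: "admissible (\<lambda>x. 0)" by (simp add: admissible_def)

lemma admissible_AE_bound: "admissible u \<Longrightarrow> AE x in M. \<bar>u x\<bar> \<le> R"
  unfolding admissible_def using abs_le_R by (auto elim: eventually_mono)

lemma admissible_L2: "admissible u \<Longrightarrow> u \<in> Lp_space 2 \<Omega>"
  using L2_bounded admissible_AE_bound by (auto simp: admissible_def)

lemma admissible_convex:
  assumes u: "admissible u" and v: "admissible v" and t: "0 \<le> t" "t \<le> 1"
  shows "admissible (\<lambda>x. (1 - t) * u x + t * v x)"
    and "(LINT x|M. h ((1 - t) * u x + t * v x))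
      \<le> (1 - t) * (LINT x|M. h (u x)) + t * (LINT x|M. h (v x))"
proof -
  have [measurable]: "u \<in> borel_measurable M" "v \<in> borel_measurable M"
    using u v by (auto simp: admissible_def)
  have int: "integrable M (\<lambda>x. (1 - t) * h (u x) + t * h (v x))"
    using u v by (auto simp: admissible_def)
  have fin: "AE x in M. g ((1 - t) * u x + t * v x) < \<infinity>"
    and le: "AE x in M. h ((1 - t) * u x + t * v x) \<le> (1 - t) * h (u x) + t * h (v x)"
    using u v h_convex[OF _ _ t] by (auto simp: admissible_def elim: eventually_elim2)
  have "integrable M (\<lambda>x. h ((1 - t) * u x + t * v x))"
  proof (rule Bochner_Integration.integrable_bound[OF int])
    show "AE x in M. norm (h ((1 - t) * u x + t * v x)) \<le> norm ((1 - t) * h (u x) + t * h (v x))"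
      using le by eventually_elim (use h_nonneg in \<open>simp add: abs_of_nonneg\<close>)
  qed measurable
  then show "admissible (\<lambda>x. (1 - t) * u x + t * v x)"
    using fin by (simp add: admissible_def)
  have "(LINT x|M. h ((1 - t) * u x + t * v x)) \<le> (LINT x|M. (1 - t) * h (u x) + t * h (v x))"
    by (intro integral_mono_AE le int) fact
  then show "(LINT x|M. h ((1 - t) * u x + t * v x))
      \<le> (1 - t) * (LINT x|M. h (u x)) + t * (LINT x|M. h (v x))"
    using u v by (simp add: admissible_def)
qed

lemma cost_admissible:
  assumes A: "A \<in> sets lebesgue" and u: "admissible u"
  shows "cost \<Omega> S yd g \<beta> u A = ereal (real_cost u A)"
proof -
  have [measurable]: "u \<in> borel_measurable M" using u by (auto simp: admissible_def)
  define f where "f x = h (u x) + indicator A x * \<beta> x" for x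
  have hint: "integrable M (\<lambda>x. h (u x))" using u by (simp add: admissible_def)
  note \<beta>int = indicator_mult_integrable[OF A \<beta>_integrable]
  have f: "integrable M f" unfolding f_def using hint \<beta>int by simp
  have AE: "AE x in M. g (u x) + ereal (indicator A x * \<beta> x) = ereal (f x)"
    using u unfolding admissible_def f_def by (auto elim!: eventually_mono simp: g_eq_h)
  have "(\<integral>\<^sup>+x. e2ennreal (g (u x) + ereal (indicator A x * \<beta> x)) \<partial>M) = (\<integral>\<^sup>+x. ennreal (f x) \<partial>M)"
    using AE by (intro nn_integral_cong_AE) (auto elim: eventually_mono)
  moreover have "(\<integral>\<^sup>+x. e2ennreal (- (g (u x) + ereal (indicator A x * \<beta> x))) \<partial>M)
      = (\<integral>\<^sup>+x. ennreal (- f x) \<partial>M)"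
    using AE by (intro nn_integral_cong_AE) (auto elim: eventually_mono)
  ultimately have "ereal_integral M (\<lambda>x. g (u x) + ereal (indicator A x * \<beta> x))
      = enn2ereal (\<integral>\<^sup>+x. ennreal (f x) \<partial>M) - enn2ereal (\<integral>\<^sup>+x. ennreal (- f x) \<partial>M)"
    by (simp add: ereal_integral_def)
  also have "\<dots> = ereal (LINT x|M. f x)"
    using f unfolding real_lebesgue_integral_def[OF f] real_integrable_def
    by (cases "\<integral>\<^sup>+x. ennreal (f x) \<partial>M"; cases "\<integral>\<^sup>+x. ennreal (- f x) \<partial>M") auto
  finally show ?thesis
    using hint \<beta>int by (simp add: cost_def real_cost_def f_def)
qed

lemma admissible_if_nn_integral:
  assumes [measurable]: "u \<in> borel_measurable M" and fin: "(\<integral>\<^sup>+x. e2ennreal (g (u x)) \<partial>M) \<le> ennreal c"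
    and c: "0 \<le> c"
  shows "admissible u" "(LINT x|M. h (u x)) \<le> c"
proof -
  have "(\<integral>\<^sup>+x. e2ennreal (g (u x)) \<partial>M) \<noteq> \<infinity>" using fin by (auto simp: top_unique)
  then have "AE x in M. e2ennreal (g (u x)) \<noteq> \<infinity>" by (intro nn_integral_PInf_AE) auto
  then have gfin: "AE x in M. g (u x) < \<infinity>" by eventually_elim auto
  have "(\<integral>\<^sup>+x. ennreal (h (u x)) \<partial>M) = (\<integral>\<^sup>+x. e2ennreal (g (u x)) \<partial>M)"
    using gfin by (intro nn_integral_cong_AE) (auto elim!: eventually_mono simp: g_eq_h)
  then have le: "(\<integral>\<^sup>+x. ennreal (h (u x)) \<partial>M) \<le> ennreal c" using fin by simp
  have int: "integrable M (\<lambda>x. h (u x))"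
    by (intro integrableI_nonneg) (use le h_nonneg in \<open>auto simp: top_unique less_top[symmetric]\<close>)
  then show "admissible u" using gfin by (simp add: admissible_def)
  have "ennreal (LINT x|M. h (u x)) \<le> ennreal c"
    using le by (subst (asm) nn_integral_eq_integral[OF int]) (auto simp: h_nonneg)
  then show "(LINT x|M. h (u x)) \<le> c" using c by simp
qed

text \<open>
  The positive part of \<open>g(u) + \<chi>\<^sub>A \<beta>\<close> is at least \<open>g(u) - \<bar>\<beta>\<bar>\<close>, and the negative part is at most
  \<open>\<bar>\<beta>\<bar>\<close>; as \<open>\<beta>\<close> is integrable, the cost can only be finite if \<open>g(u)\<close> is integrable.
\<close>

lemma cost_not_admissible:
  assumes A: "A \<in> sets lebesgue" and [measurable]: "u \<in> borel_measurable M" and u: "\<not> admissible u"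
  shows "cost \<Omega> S yd g \<beta> u A = \<infinity>"
proof -
  let ?k = "\<lambda>x. g (u x) + ereal (indicator A x * \<beta> x)"
  note [measurable] = indicator_measurable_M[OF A]
  have \<beta>fin: "(\<integral>\<^sup>+x. ennreal \<bar>\<beta> x\<bar> \<partial>M) < \<infinity>"
    using \<beta>_integrable by (simp add: integrable_iff_bounded)
  have "(\<integral>\<^sup>+x. e2ennreal (g (u x)) \<partial>M) \<le> (\<integral>\<^sup>+x. e2ennreal (?k x) + ennreal \<bar>\<beta> x\<bar> \<partial>M)"
  proof (intro nn_integral_mono)
    fix x
    show "e2ennreal (g (u x)) \<le> e2ennreal (?k x) + ennreal \<bar>\<beta> x\<bar>"
    proof (cases "g (u x) < \<infinity>")
      case True
      have "ennreal (h (u x)) \<le> ennreal (h (u x) + indicator A x * \<beta> x) + ennreal \<bar>\<beta> x\<bar>"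
      proof (cases "0 \<le> h (u x) + indicator A x * \<beta> x")
        case True
        have "ennreal (h (u x)) \<le> ennreal ((h (u x) + indicator A x * \<beta> x) + \<bar>\<beta> x\<bar>)"
          by (intro ennreal_leI) (auto simp: indicator_def)
        also have "\<dots> = ennreal (h (u x) + indicator A x * \<beta> x) + ennreal \<bar>\<beta> x\<bar>"
          using True by (intro ennreal_plus) auto
        finally show ?thesis .
      next
        case False
        then have "h (u x) \<le> \<bar>\<beta> x\<bar>" using h_nonneg[of "u x"] by (cases "x \<in> A") auto
        then show ?thesis by (intro add_increasing ennreal_leI) auto
      qed
      then show ?thesis using g_eq_h[OF True] by simp
    qed auto
  qed
  also have "\<dots> = (\<integral>\<^sup>+x. e2ennreal (?k x) \<partial>M) + (\<integral>\<^sup>+x. ennreal \<bar>\<beta> x\<bar> \<partial>M)"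
    by (intro nn_integral_add) auto
  finally have le: "(\<integral>\<^sup>+x. e2ennreal (g (u x)) \<partial>M) \<le> \<dots>" .
  have "(\<integral>\<^sup>+x. e2ennreal (g (u x)) \<partial>M) = top"
  proof (cases "\<integral>\<^sup>+x. e2ennreal (g (u x)) \<partial>M")
    case (real r)
    then show ?thesis using admissible_if_nn_integral(1)[of u r] u by auto
  qed
  then have pos: "(\<integral>\<^sup>+x. e2ennreal (?k x) \<partial>M) = top"
    using le \<beta>fin by (auto simp: top_unique)
  have "(\<integral>\<^sup>+x. e2ennreal (- ?k x) \<partial>M) \<le> (\<integral>\<^sup>+x. ennreal \<bar>\<beta> x\<bar> \<partial>M)"
  proof (intro nn_integral_mono)
    fix x
    show "e2ennreal (- ?k x) \<le> ennreal \<bar>\<beta> x\<bar>"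
    proof (cases "g (u x) < \<infinity>")
      case True
      then show ?thesis
        using g_eq_h[OF True] h_nonneg[of "u x"] by (auto intro!: ennreal_leI simp: indicator_def)
    qed (auto simp: e2ennreal_neg)
  qed
  then have "(\<integral>\<^sup>+x. e2ennreal (- ?k x) \<partial>M) \<noteq> top" using \<beta>fin by (auto simp: top_unique)
  then have "ereal_integral M ?k = \<infinity>"
    unfolding ereal_integral_def pos by (cases "\<integral>\<^sup>+x. e2ennreal (- ?k x) \<partial>M") auto
  then show ?thesis by (simp add: cost_def)
qed

section \<open>Existence of optimal controls\<close>

lemma e2ennreal_g_liminf:
  assumes "w \<longlonglongrightarrow> v"
  shows "e2ennreal (g v) \<le> liminf (\<lambda>i. e2ennreal (g (w i)))"
  unfolding le_Liminf_iff
proof (intro allI impI)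
  fix y assume "y < e2ennreal (g v)"
  then have "enn2ereal y < g v"
    by (simp add: less_ennreal.rep_eq enn2ereal_e2ennreal[OF g_nonneg])
  then have "\<forall>\<^sub>F i in sequentially. enn2ereal y < g (w i)"
    by (rule eventually_compose_filterlim[OF eventually_less_g assms])
  then show "\<forall>\<^sub>F i in sequentially. y < e2ennreal (g (w i))"
    by eventually_elim (simp add: less_ennreal.rep_eq enn2ereal_e2ennreal[OF g_nonneg])
qed

lemma admissible_sq_integral_le: 
  assumes "admissible u" shows "(LINT x|M. (u x)\<^sup>2) \<le> R\<^sup>2 * measure M (space M)"
proof -
  have "(LINT x|M. (u x)\<^sup>2) \<le> (LINT x|M. R\<^sup>2)"
  proof (rule integral_mono_AE)
    show "integrable M (\<lambda>x. (u x)\<^sup>2)" using admissible_L2[OF assms] by (simp add: L2_iff)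
    show "AE x in M. (u x)\<^sup>2 \<le> R\<^sup>2"
      using admissible_AE_bound[OF assms]
    proof eventually_elim
      case (elim x)
      then show ?case using power_mono[of "\<bar>u x\<bar>" R 2] by simp
    qed
  qed simp
  then show ?thesis by (simp add: mult.commute)
qed

lemma real_cost_midpoint:
  assumes A: "A \<in> sets lebesgue" and u: "admissible u" and v: "admissible v"
  shows "real_cost (\<lambda>x. (1/2) * u x + (1/2) * v x) A \<le> (1/2) * real_cost u A + (1/2) * real_cost v A"
proof -
  let ?i = "\<lambda>u x. indicator A x * u x"
  note L = L2_indicator[OF A admissible_L2[OF u]] L2_indicator[OF A admissible_L2[OF v]]
  have "?i (\<lambda>x. (1/2) * u x + (1/2) * v x) = (\<lambda>x. (1/2) * ?i u x + (1/2) * ?i v x)"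
    by (auto simp: algebra_simps)
  then have "S (?i (\<lambda>x. (1/2) * u x + (1/2) * v x)) = (1/2) *\<^sub>R S (?i u) + (1/2) *\<^sub>R S (?i v)"
    using S_add[OF L2_cmult[OF L(1), of "1/2"] L2_cmult[OF L(2), of "1/2"]]
      S_cmult[OF L(1), of "1/2"] S_cmult[OF L(2), of "1/2"] by simp
  then have "S (?i (\<lambda>x. (1/2) * u x + (1/2) * v x)) - yd
      = (1/2) *\<^sub>R (S (?i u) - yd) + (1/2) *\<^sub>R (S (?i v) - yd)"
    by (simp add: algebra_simps flip: scaleR_add_left)
  then have "(norm (S (?i (\<lambda>x. (1/2) * u x + (1/2) * v x)) - yd))\<^sup>2
      \<le> (1/2) * (norm (S (?i u) - yd))\<^sup>2 + (1/2) * (norm (S (?i v) - yd))\<^sup>2"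
    using norm_midpoint_sq by simp
  moreover have "(LINT x|M. h ((1/2) * u x + (1/2) * v x))
      \<le> (1/2) * (LINT x|M. h (u x)) + (1/2) * (LINT x|M. h (v x))"
    using admissible_convex(2)[OF u v, of "1/2"] by simp
  ultimately show ?thesis unfolding real_cost_def by argo
qed

text \<open>
  With the infimum \<open>m\<close>, the sublevel sets of the cost at heights \<open>m + 1 / (n + 1)\<close> are decreasing,
  closed under midpoints and bounded in \<open>L\<^sup>2\<close>. They contain an \<open>L\<^sup>2\<close> Cauchy sequence, a subsequence
  of which converges almost everywhere. Along it the tracking term converges, because the controls
  are uniformly bounded, and \<open>\<integral> g(u)\<close> is lower semicontinuous by Fatou's lemma.
\<close>

lemma exists_minimizer:
  assumes A: "A \<in> sets lebesgue"
  obtains v where "admissible v" "\<And>u. admissible u \<Longrightarrow> real_cost v A \<le> real_cost u A"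
proof -
  let ?J = "\<lambda>u. real_cost u A" and ?b = "LINT x|M. indicator A x * \<beta> x"
  let ?P = "\<lambda>u. 1 / 2 * (norm (S (\<lambda>x. indicator A x * u x) - yd))\<^sup>2"
  define m where "m = Inf (?J ` Collect admissible)"
  have lower: "?b \<le> ?J u" for u
    unfolding real_cost_def using h_nonneg by (simp add: Bochner_Integration.integral_nonneg)
  have bdd: "bdd_below (?J ` Collect admissible)" by (rule bdd_belowI[of _ ?b]) (use lower in auto)
  have m_le: "m \<le> ?J u" if "admissible u" for u
    unfolding m_def using that by (intro cInf_lower bdd) auto
  define K where "K n = {u. admissible u \<and> ?J u \<le> m + 1 / real (Suc n)}" for n
  have ne: "K n \<noteq> {}" for n
    using cInf_lessD[of "?J ` Collect admissible" "m + 1 / real (Suc n)"] admissible_0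
    by (force simp: m_def K_def)
  have dec: "K n \<subseteq> K k" if "k \<le> n" for k n
  proof -
    have "1 / real (Suc n) \<le> 1 / real (Suc k)" using that by (simp add: frac_le)
    then show ?thesis unfolding K_def by auto
  qed
  have mid: "(\<lambda>x. (1/2) * u x + (1/2) * v x) \<in> K n" if "u \<in> K n" "v \<in> K n" for n u v
    using that admissible_convex(1)[of u v "1/2"] real_cost_midpoint[OF A, of u v]
    unfolding K_def by fastforce
  obtain u where u: "\<And>n. u n \<in> K n"
    "\<And>e. 0 < e \<Longrightarrow> \<exists>N. \<forall>i\<ge>N. \<forall>j\<ge>N. (LINT x|M. (u i x - u j x)\<^sup>2) < e"
  proof (rule near_minimal_norm_sequence_Cauchy[of K M "R\<^sup>2 * measure M (space M)"])
    show "w \<in> borel_measurable M" "integrable M (\<lambda>x. (w x)\<^sup>2)"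
      "(LINT x|M. (w x)\<^sup>2) \<le> R\<^sup>2 * measure M (space M)" if "w \<in> K n" for n w
      using that admissible_L2[of w] admissible_sq_integral_le[of w] by (auto simp: K_def L2_iff)
  qed (use ne dec mid in auto)
  have adm: "admissible (u n)" and Ju: "?J (u n) \<le> m + 1 / real (Suc n)" for n
    using u(1)[of n] by (auto simp: K_def)
  note uL2 = admissible_L2[OF adm]
  have [measurable]: "u n \<in> borel_measurable M" for n using adm by (simp add: admissible_def)
  obtain r v where r: "strict_mono r" and [measurable]: "v \<in> borel_measurable M"
    and lim: "AE x in M. (\<lambda>i. u (r i) x) \<longlonglongrightarrow> v x"
    using L2_Cauchy_AE_convergent_subseq[of u] uL2 u(2) by (auto simp: L2_iff)
  have bnd: "AE x in M. \<forall>n. \<bar>u n x\<bar> \<le> R"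
    unfolding AE_all_countable using admissible_AE_bound[OF adm] by blast
  have vR: "AE x in M. \<bar>v x\<bar> \<le> R"
    using lim bnd
  proof eventually_elim
    case (elim x)
    then show ?case using LIMSEQ_le_const2[OF tendsto_rabs[OF elim(1)]] by blast
  qed
  have vL2: "v \<in> Lp_space 2 \<Omega>" by (rule L2_bounded[OF _ vR]) measurable
  have Slim: "(\<lambda>i. S (\<lambda>x. indicator A x * u (r i) x)) \<longlonglongrightarrow> S (\<lambda>x. indicator A x * v x)"
  proof (rule S_tendsto)
    note [measurable] = indicator_measurable_M[OF A]
    have "(\<lambda>i. LINT x|M. (indicator A x * u (r i) x - indicator A x * v x)\<^sup>2) \<longlonglongrightarrow> (LINT x|M. 0)"
    proof (rule integral_dominated_convergence[where w="\<lambda>_. (2 * R)\<^sup>2"])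
      show "AE x in M. (\<lambda>i. (indicator A x * u (r i) x - indicator A x * v x)\<^sup>2) \<longlonglongrightarrow> 0"
        using lim
      proof eventually_elim
        case (elim x)
        have "(\<lambda>i. (indicator A x * u (r i) x - indicator A x * v x)\<^sup>2)
            \<longlonglongrightarrow> (indicator A x * v x - indicator A x * v x)\<^sup>2"
          by (intro tendsto_intros elim)
        then show ?case by simp
      qed
      show "AE x in M. norm ((indicator A x * u (r i) x - indicator A x * v x)\<^sup>2) \<le> (2 * R)\<^sup>2" for i
        using bnd vR
      proof eventually_elim
        case (elim x)
        then have "\<bar>u (r i) x\<bar> \<le> R" by blast
        then have "\<bar>indicator A x * u (r i) x - indicator A x * v x\<bar> \<le> 2 * R"
          using elim(2) R_pos by (auto simp: indicator_def)
        then have "\<bar>indicator A x * u (r i) x - indicator A x * v x\<bar>\<^sup>2 \<le> (2 * R)\<^sup>2"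
          by (rule power_mono) simp
        then show ?case by simp
      qed
    qed auto
    then show "(\<lambda>i. LINT x|M. (indicator A x * u (r i) x - indicator A x * v x)\<^sup>2) \<longlonglongrightarrow> 0"
      by simp
  qed (use L2_indicator[OF A] uL2 vL2 in auto)
  \<comment> \<open>an upper bound for \<open>\<integral> g(u)\<close> along the subsequence, with a limit that is known\<close>
  define b where "b i = m + 1 / real (Suc (r i)) - ?P (u (r i)) - ?b" for i
  have hb: "(LINT x|M. h (u (r i) x)) \<le> b i" for i
    using Ju[of "r i"] unfolding b_def real_cost_def by linarith
  have b0: "0 \<le> b i" for i
    by (rule order_trans[OF Bochner_Integration.integral_nonneg hb[of i]]) (rule h_nonneg)
  have "(\<lambda>i. 1 / real (Suc (r i))) \<longlonglongrightarrow> 0"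
    using LIMSEQ_subseq_LIMSEQ[OF LIMSEQ_Suc[OF lim_1_over_n] r] by (simp add: o_def)
  then have "b \<longlonglongrightarrow> m + 0 - ?P v - ?b"
    unfolding b_def by (intro tendsto_intros Slim)
  then have blim: "b \<longlonglongrightarrow> m - ?P v - ?b" by simp
  have c0: "0 \<le> m - ?P v - ?b" by (rule LIMSEQ_le_const[OF blim]) (use b0 in auto)
  have "(\<integral>\<^sup>+x. e2ennreal (g (v x)) \<partial>M) \<le> (\<integral>\<^sup>+x. liminf (\<lambda>i. e2ennreal (g (u (r i) x))) \<partial>M)"
    using lim by (intro nn_integral_mono_AE) (auto elim!: eventually_mono intro: e2ennreal_g_liminf)
  also have "\<dots> \<le> liminf (\<lambda>i. \<integral>\<^sup>+x. e2ennreal (g (u (r i) x)) \<partial>M)"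
    by (intro nn_integral_liminf) measurable
  also have "\<dots> \<le> liminf (\<lambda>i. ennreal (b i))"
  proof (intro Liminf_mono always_eventually allI)
    fix i
    have "(\<integral>\<^sup>+x. e2ennreal (g (u (r i) x)) \<partial>M) = (\<integral>\<^sup>+x. ennreal (h (u (r i) x)) \<partial>M)"
      using adm[of "r i"] unfolding admissible_def
      by (intro nn_integral_cong_AE) (auto elim!: eventually_mono simp: g_eq_h)
    also have "\<dots> = ennreal (LINT x|M. h (u (r i) x))"
      using adm[of "r i"] h_nonneg by (intro nn_integral_eq_integral) (auto simp: admissible_def)
    also have "\<dots> \<le> ennreal (b i)" by (intro ennreal_leI hb)
    finally show "(\<integral>\<^sup>+x. e2ennreal (g (u (r i) x)) \<partial>M) \<le> ennreal (b i)" .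
  qed
  also have "\<dots> = ennreal (m - ?P v - ?b)"
    by (intro lim_imp_Liminf tendsto_ennrealI blim) simp
  finally have fin: "(\<integral>\<^sup>+x. e2ennreal (g (v x)) \<partial>M) \<le> ennreal (m - ?P v - ?b)" .
  show ?thesis
  proof (rule that)
    show "admissible v" using admissible_if_nn_integral(1)[OF _ fin c0] by simp
    have "?J v \<le> m"
      using admissible_if_nn_integral(2)[OF _ fin c0] by (simp add: real_cost_def)
    then show "?J v \<le> ?J w" if "admissible w" for w using m_le[OF that] by linarith
  qed
qed

lemma value_function_real:
  assumes A: "A \<in> sets lebesgue"
  obtains V where "value_function \<Omega> S yd g \<beta> A = ereal V"
    "\<And>u. admissible u \<Longrightarrow> V \<le> real_cost u A"
    "\<And>c. (\<And>u. admissible u \<Longrightarrow> c \<le> real_cost u A) \<Longrightarrow> c \<le> V"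
proof -
  obtain v where v: "admissible v" "\<And>u. admissible u \<Longrightarrow> real_cost v A \<le> real_cost u A"
    using exists_minimizer[OF A] by blast
  have "value_function \<Omega> S yd g \<beta> A = ereal (real_cost v A)"
    unfolding value_function_def
  proof (rule Least_equality)
    show "ereal (real_cost v A) \<in> (\<lambda>u. cost \<Omega> S yd g \<beta> u A) ` Lp_space 2 \<Omega>"
      using cost_admissible[OF A v(1)] admissible_L2[OF v(1)] by (metis image_eqI)
    fix y assume "y \<in> (\<lambda>u. cost \<Omega> S yd g \<beta> u A) ` Lp_space 2 \<Omega>"
    then obtain u where u: "u \<in> Lp_space 2 \<Omega>" "y = cost \<Omega> S yd g \<beta> u A" by blast
    show "ereal (real_cost v A) \<le> y"
    proof (cases "admissible u")
      case True
      then show ?thesis using u v(2) cost_admissible[OF A] by simp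
    next
      case False
      then show ?thesis using u cost_not_admissible[OF A] by (simp add: L2_iff)
    qed
  qed
  then show ?thesis using v that by blast
qed

section \<open>Controls with small support\<close>

lemma integral_indicator_M_le:
  assumes "D \<in> lmeasurable"
  shows "(LINT x|M. indicator D x) \<le> measure lebesgue D"
proof -
  have "(LINT x|M. indicator D x) = (LINT x|lebesgue. indicator \<Omega> x *\<^sub>R indicator D x :: real)"
    using \<Omega>_sets by (intro integral_restrict_space) simp
  also have "\<dots> = (LINT x|lebesgue. indicator (\<Omega> \<inter> D) x)"
    by (intro Bochner_Integration.integral_cong) (auto simp: indicator_def)
  also have "\<dots> = measure lebesgue (\<Omega> \<inter> D)" by simp
  also have "\<dots> \<le> measure lebesgue D"
    using assms \<Omega>_sets by (intro measure_mono_fmeasurable) auto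
  finally show ?thesis .
qed

text \<open>
  With \<open>f = S\<^sup>*S w\<close> one has \<open>\<parallel>S w\<parallel>\<^sup>2 = \<integral> w f \<le> R \<integral>\<^sub>D \<bar>f\<bar>\<close>, and the \<open>L\<^sup>q\<close> norm of \<open>f\<close> is at most
  \<open>C \<parallel>S w\<parallel>\<close>. Hoelder's inequality makes the right-hand side a multiple of
  \<open>\<parallel>S w\<parallel> m\<^bsup>1 - 1/q\<^esup>\<close>, one factor \<open>\<parallel>S w\<parallel>\<close> cancels, and squaring gives the claim.
\<close>

lemma S_small_support:
  obtains K where
    "\<And>w D m. w \<in> Lp_space 2 \<Omega> \<Longrightarrow> D \<in> lmeasurable \<Longrightarrow> measure lebesgue D \<le> m \<Longrightarrow> 0 < m \<Longrightarrow>
      AE x in M. \<bar>w x\<bar> \<le> R * indicator D x \<Longrightarrow> (norm (S w))\<^sup>2 \<le> K * m powr (2 - 2 / q)"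
proof -
  obtain C' where C': "\<And>y. Lp_norm q \<Omega> (Sadj y) \<le> C' * norm y"
    using Sadj_bounded_linear unfolding bounded_linear_to_Lp_def by blast
  define C where "C = max 1 C'"
  have C: "0 < C" "Lp_norm q \<Omega> (Sadj y) \<le> C * norm y" for y
    using order_trans[OF C'[of y] mult_right_mono[of C' C "norm y"]] by (auto simp: C_def)
  show ?thesis
  proof (rule that[of "(2 * R * C)\<^sup>2"])
    fix w D m
    assume w: "w \<in> Lp_space 2 \<Omega>" and D: "D \<in> lmeasurable" "measure lebesgue D \<le> m" and m: "0 < m"
      and wD: "AE x in M. \<bar>w x\<bar> \<le> R * indicator D x"
    define s where "s = norm (S w)"
    define f where "f = Sadj (S w)"
    have [measurable]: "f \<in> borel_measurable M" and fq: "integrable M (\<lambda>x. \<bar>f x\<bar> powr q)"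
      using Sadj_bounded_linear by (auto simp: bounded_linear_to_Lp_def Lp_space_def f_def)
    have "s \<le> 2 * R * C * m powr (1 - 1 / q)"
    proof (cases "s = 0")
      case False
      then have s: "0 < s" by (simp add: s_def)
      define c where "c = C * s"
      have c: "0 < c" using C s by (simp add: c_def)
      \<comment> \<open>the threshold at which both parts of the bound on \<open>\<integral>\<^sub>D \<bar>f\<bar>\<close> become \<open>c m\<^bsup>1 - 1/q\<^esup>\<close>\<close>
      define l where "l = c * m powr (- (1 / q))"
      have l: "0 < l" using c m by (simp add: l_def)
      have "0 \<le> (LINT x|M. \<bar>f x\<bar> powr q)" by simp
      moreover have "(LINT x|M. \<bar>f x\<bar> powr q) powr (1 / q) \<le> c"
        using C(2)[of "S w"] by (simp add: Lp_norm_def f_def c_def s_def)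
      ultimately have "((LINT x|M. \<bar>f x\<bar> powr q) powr (1 / q)) powr q \<le> c powr q"
        using q_gt by (intro powr_mono2) auto
      then have Iq: "(LINT x|M. \<bar>f x\<bar> powr q) \<le> c powr q"
        using q_gt by (simp add: powr_powr)
      have ind: "integrable M (indicat_real D)"
        using indicator_mult_integrable[of D "\<lambda>_. 1"] D by (auto simp: fmeasurable_def)
      have "s\<^sup>2 = (LINT x|M. w x * f x)"
        using S_inner[OF w, of "S w"] by (simp add: s_def f_def power2_norm_eq_inner)
      also have "\<dots> \<le> (LINT x|M. R * (l * indicator D x + l powr (1 - q) * \<bar>f x\<bar> powr q))"
      proof (rule integral_mono_AE)
        show "integrable M (\<lambda>x. w x * f x)"
          unfolding f_def by (rule L2_mult_integrable[OF w Sadj_L2])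
        show "integrable M (\<lambda>x. R * (l * indicator D x + l powr (1 - q) * \<bar>f x\<bar> powr q))"
          using ind fq by simp
        show "AE x in M. w x * f x \<le> R * (l * indicator D x + l powr (1 - q) * \<bar>f x\<bar> powr q)"
          using wD
        proof eventually_elim
          case (elim x)
          have "w x * f x \<le> \<bar>w x\<bar> * \<bar>f x\<bar>" by (simp flip: abs_mult)
          also have "\<dots> \<le> (R * indicator D x) * \<bar>f x\<bar>" by (intro mult_right_mono elim) simp
          also have "\<dots> \<le> R * (l * indicator D x + l powr (1 - q) * \<bar>f x\<bar> powr q)"
            using abs_le_threshold_plus_power[OF l, of q "f x"] q_gt R_pos by (cases "x \<in> D") (auto intro!: mult_left_mono)
          finally show ?case .
        qed
      qed
      also have "\<dots> = R * (l * (LINT x|M. indicator D x) + l powr (1 - q) * (LINT x|M. \<bar>f x\<bar> powr q))"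
        using ind fq by simp
      also have "\<dots> \<le> R * (l * m + l powr (1 - q) * c powr q)"
        using R_pos l Iq order_trans[OF integral_indicator_M_le[OF D(1)] D(2)]
        by (intro mult_left_mono add_mono) auto
      also have "l * m = c * m powr (1 - 1 / q)"
        using m by (simp add: l_def powr_diff powr_minus_divide)
      also have "l powr (1 - q) * c powr q = c * m powr (1 - 1 / q)"
      proof -
        have "l powr (1 - q) = c powr (1 - q) * m powr (- (1 / q) * (1 - q))"
          using c m by (simp add: l_def powr_mult powr_powr)
        moreover have "- (1 / q) * (1 - q) = 1 - 1 / q" using q_gt by (simp add: field_simps)
        moreover have "c powr (1 - q) * c powr q = c" using c by (simp flip: powr_add)
        ultimately show ?thesis by (simp add: mult_ac)
      qed
      finally have "s * s \<le> (2 * R * C * m powr (1 - 1 / q)) * s"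
        by (simp add: c_def power2_eq_square algebra_simps)
      then show ?thesis using s by (simp only: mult_le_cancel_right_pos)
    qed (use C(1) R_pos in simp)
    then have "s\<^sup>2 \<le> (2 * R * C * m powr (1 - 1 / q))\<^sup>2"
      by (rule power_mono) (simp add: s_def)
    also have "\<dots> = (2 * R * C)\<^sup>2 * (m powr (1 - 1 / q))\<^sup>2" by (simp add: power_mult_distrib)
    also have "(m powr (1 - 1 / q))\<^sup>2 = m powr (2 - 2 / q)"
      using m by (simp add: power2_eq_square flip: powr_add)
    finally show "(norm (S w))\<^sup>2 \<le> (2 * R * C)\<^sup>2 * m powr (2 - 2 / q)" by (simp add: s_def)
  qed
qed

end

section \<open>The pointwise minimum principle\<close>

locale control_solution = control_problem g \<Omega> S Sadj yd \<beta> q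
  for g and \<Omega> :: "'a::euclidean_space set" and S :: "('a \<Rightarrow> real) \<Rightarrow> 'y::real_inner"
    and Sadj yd \<beta> q +
  fixes B :: "'a set" and uB :: "'a \<Rightarrow> real" and yB :: 'y and pB :: "'a \<Rightarrow> real"
  assumes B_sets: "B \<in> sets lebesgue" and B_sub: "B \<subseteq> \<Omega>"
    and solution: "is_solution \<Omega> S Sadj yd g \<beta> B uB yB pB"
begin

lemma uB_L2: "uB \<in> Lp_space 2 \<Omega>"
  and uB_minimal_cost: "v \<in> Lp_space 2 \<Omega> \<Longrightarrow> cost \<Omega> S yd g \<beta> uB B \<le> cost \<Omega> S yd g \<beta> v B"
  using solution by (auto simp: is_solution_def is_arg_min_def not_less)

lemma uB_admissible: "admissible uB"
proof (rule ccontr)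
  assume "\<not> admissible uB"
  then have "cost \<Omega> S yd g \<beta> uB B = \<infinity>"
    using cost_not_admissible[OF B_sets] uB_L2 by (simp add: L2_iff)
  then show False
    using uB_minimal_cost[OF admissible_L2[OF admissible_0]] cost_admissible[OF B_sets admissible_0] by simp
qed

lemma uB_minimal: "admissible v \<Longrightarrow> real_cost uB B \<le> real_cost v B"
  using uB_minimal_cost[OF admissible_L2[of v]] cost_admissible[OF B_sets] uB_admissible by simp

lemma uB_outside: "AE x in M. x \<notin> B \<longrightarrow> uB x = 0"
  and yB_eq: "yB = S (\<lambda>x. indicator B x * uB x)"
  and pB_eq: "AE x in M. pB x = Sadj (yB - yd) x"
  using solution by (auto simp: is_solution_def elim: eventually_mono)

lemma S_uB: "S uB = yB"
  unfolding yB_eq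
  by (rule S_cong_AE[OF uB_L2 L2_indicator[OF B_sets uB_L2]])
     (use uB_outside in \<open>auto elim!: eventually_mono simp: indicator_def\<close>)

text \<open>
  The adjoint state, in the representative that is known to be measurable; \<open>pB\<close> only agrees with it
  almost everywhere.
\<close>

definition P :: "'a \<Rightarrow> real" where "P = Sadj (yB - yd)"

lemma P_L2: "P \<in> Lp_space 2 \<Omega>" unfolding P_def by (rule Sadj_L2)

lemma P_measurable [measurable]: "P \<in> borel_measurable M" using P_L2 by (simp add: L2_iff)

lemma uB_measurable [measurable]: "uB \<in> borel_measurable M" using uB_L2 by (simp add: L2_iff)

lemma abs_P_integrable: "integrable M (\<lambda>x. R * \<bar>P x\<bar>)"
  using L2_integrable[OF P_L2] by simp

lemma H_P_integrable: "integrable M (\<lambda>x. H (P x))"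
  by (rule Bochner_Integration.integrable_bound[OF abs_P_integrable])
     (use abs_H_le R_pos in \<open>auto simp: abs_mult\<close>)

lemma h_sel_P_integrable: "integrable M (\<lambda>x. h (sel (P x)))"
  by (rule Bochner_Integration.integrable_bound[OF abs_P_integrable])
     (use h_sel_le h_nonneg R_pos in \<open>auto simp: abs_mult\<close>)

text \<open>
  The second-order Taylor expansion of the quadratic tracking term at \<open>u\<^sub>B\<close>; its gradient is \<open>P\<close>.
\<close>

lemma tracking_expansion:
  assumes w: "w \<in> Lp_space 2 \<Omega>"
  shows "1 / 2 * (norm (S w - yd))\<^sup>2 = 1 / 2 * (norm (yB - yd))\<^sup>2
    + (LINT x|M. P x * (w x - uB x)) + 1 / 2 * (norm (S (\<lambda>x. w x - uB x)))\<^sup>2"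
proof -
  have d: "S (\<lambda>x. w x - uB x) = S w - yB" using S_diff[OF w uB_L2] S_uB by simp
  have "(LINT x|M. P x * (w x - uB x)) = (S w - yB) \<bullet> (yB - yd)"
    using S_inner[OF L2_diff[OF w uB_L2], of "yB - yd"] by (simp add: d P_def mult.commute)
  moreover have "(norm (S w - yd))\<^sup>2
      = (norm (yB - yd))\<^sup>2 + 2 * ((S w - yB) \<bullet> (yB - yd)) + (norm (S w - yB))\<^sup>2"
    by (simp add: power2_norm_eq_inner algebra_simps inner_commute)
  ultimately show ?thesis by (simp add: d)
qed

lemma cost_expansion:
  assumes A: "A \<in> sets lebesgue" and u: "admissible u"
  defines "w \<equiv> \<lambda>x. indicator A x * u x"
  defines "k \<equiv> \<lambda>x. P x * (w x - uB x) + h (u x) - h (uB x) + (indicator A x - indicator B x) * \<beta> x"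
  shows "integrable M k"
    and "real_cost u A = real_cost uB B + (LINT x|M. k x) + 1 / 2 * (norm (S (\<lambda>x. w x - uB x)))\<^sup>2"
proof -
  have w: "w \<in> Lp_space 2 \<Omega>" unfolding w_def by (rule L2_indicator[OF A admissible_L2[OF u]])
  note int = L2_mult_integrable[OF P_L2 L2_diff[OF w uB_L2]]
    indicator_mult_integrable[OF A \<beta>_integrable] indicator_mult_integrable[OF B_sets \<beta>_integrable]
  have hint: "integrable M (\<lambda>x. h (u x))" "integrable M (\<lambda>x. h (uB x))"
    using u uB_admissible by (auto simp: admissible_def)
  have k: "k = (\<lambda>x. P x * (w x - uB x) + h (u x) - h (uB x)
      + (indicator A x * \<beta> x - indicator B x * \<beta> x))"
    by (auto simp: k_def left_diff_distrib)
  show "integrable M k" unfolding k using int hint by simp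
  have "(LINT x|M. k x) = (LINT x|M. P x * (w x - uB x)) + (LINT x|M. h (u x)) - (LINT x|M. h (uB x))
      + ((LINT x|M. indicator A x * \<beta> x) - (LINT x|M. indicator B x * \<beta> x))"
    unfolding k using int hint by simp
  then show "real_cost u A
      = real_cost uB B + (LINT x|M. k x) + 1 / 2 * (norm (S (\<lambda>x. w x - uB x)))\<^sup>2"
    using tracking_expansion[OF w]
    unfolding real_cost_def w_def[symmetric] yB_eq[symmetric] by linarith
qed

lemma patched_control_admissible:
  assumes C: "C \<in> sets lebesgue" and E: "E \<in> sets lebesgue" and disj: "C \<inter> E = {}"
  defines "v \<equiv> \<lambda>x. indicator C x * uB x + indicator E x * sel (P x)"
  shows "admissible v"
  unfolding admissible_def
proof (intro conjI)
  note [measurable] = indicator_measurable_M[OF C] indicator_measurable_M[OF E]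
  show "v \<in> borel_measurable M" unfolding v_def by measurable
  have v: "v x = (if x \<in> C then uB x else if x \<in> E then sel (P x) else 0)" for x
    using disj by (auto simp: v_def indicator_def)
  have "AE x in M. g (uB x) < \<infinity>" using uB_admissible by (simp add: admissible_def)
  then show "AE x in M. g (v x) < \<infinity>" by eventually_elim (use g_sel in \<open>auto simp: v\<close>)
  have "(\<lambda>x. h (v x)) = (\<lambda>x. indicator C x * h (uB x) + indicator E x * h (sel (P x)))"
    using disj by (intro ext) (auto simp: v disjoint_iff)
  then show "integrable M (\<lambda>x. h (v x))"
    using indicator_mult_integrable[OF C, of "\<lambda>x. h (uB x)"] uB_admissible
      indicator_mult_integrable[OF E h_sel_P_integrable]
    by (simp add: admissible_def)
qed

text \<open>
  Move from \<open>u\<^sub>B\<close> towards \<open>v\<close> by a step \<open>t\<close>. By convexity of \<open>g\<close> the cost changes by at most \<open>t\<close>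
  times the expression below plus \<open>t\<^sup>2 / 2\<close> times a constant, and it does not decrease. Divide by \<open>t\<close>
  and let \<open>t\<close> tend to \<open>0\<close>.
\<close>

lemma first_order_condition:
  assumes v: "admissible v"
  shows "0 \<le> (LINT x|M. P x * (indicator B x * v x - uB x)) + (LINT x|M. h (v x)) - (LINT x|M. h (uB x))"
proof -
  let ?w = "\<lambda>x. indicator B x * v x"
  let ?I = "LINT x|M. P x * (?w x - uB x)"
  let ?N = "(norm (S (\<lambda>x. ?w x - uB x)))\<^sup>2"
  let ?d = "?I + (LINT x|M. h (v x)) - (LINT x|M. h (uB x))"
  have w: "?w \<in> Lp_space 2 \<Omega>" by (rule L2_indicator[OF B_sets admissible_L2[OF v]])
  note wd = L2_diff[OF w uB_L2]
  have "0 \<le> ?d + t / 2 * ?N" if t: "0 < t" "t \<le> 1" for t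
  proof -
    let ?u = "\<lambda>x. (1 - t) * uB x + t * v x"
    have u: "admissible ?u" using admissible_convex(1)[OF uB_admissible v] t by simp
    let ?z = "\<lambda>x. indicator B x * ?u x"
    have z: "?z \<in> Lp_space 2 \<Omega>" by (rule L2_indicator[OF B_sets admissible_L2[OF u]])
    have zw: "AE x in M. ?z x - uB x = t * (?w x - uB x)"
      using uB_outside by eventually_elim (auto simp: indicator_def algebra_simps)
    have "S (\<lambda>x. ?z x - uB x) = S (\<lambda>x. t * (?w x - uB x))"
      by (rule S_cong_AE[OF L2_diff[OF z uB_L2] L2_cmult[OF wd] zw])
    then have N: "(norm (S (\<lambda>x. ?z x - uB x)))\<^sup>2 = t\<^sup>2 * ?N"
      using S_cmult[OF wd] by (simp add: power_mult_distrib)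
    have "(LINT x|M. P x * (?z x - uB x)) = (LINT x|M. t * (P x * (?w x - uB x)))"
    proof (rule integral_cong_AE)
      show "AE x in M. P x * (?z x - uB x) = t * (P x * (?w x - uB x))"
        using zw by eventually_elim simp
    qed (use L2_mult_integrable[OF P_L2 L2_diff[OF z uB_L2]] L2_mult_integrable[OF P_L2 wd]
        in \<open>auto intro: borel_measurable_integrable\<close>)
    then have I: "(LINT x|M. P x * (?z x - uB x)) = t * ?I" by simp
    have "1 / 2 * (norm (yB - yd))\<^sup>2 + (LINT x|M. h (uB x)) \<le> 1 / 2 * (norm (S ?z - yd))\<^sup>2 + (LINT x|M. h (?u x))"
      using uB_minimal[OF u] unfolding real_cost_def yB_eq[symmetric] by linarith
    also have "\<dots> = 1 / 2 * (norm (yB - yd))\<^sup>2 + t * ?I + 1 / 2 * (t\<^sup>2 * ?N) + (LINT x|M. h (?u x))"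
      using tracking_expansion[OF z] unfolding I N by linarith
    finally have "0 \<le> t * ?I + 1 / 2 * (t\<^sup>2 * ?N) + (LINT x|M. h (?u x)) - (LINT x|M. h (uB x))"
      by linarith
    also have "\<dots> \<le> t * ?I + 1 / 2 * (t\<^sup>2 * ?N)
        + ((1 - t) * (LINT x|M. h (uB x)) + t * (LINT x|M. h (v x))) - (LINT x|M. h (uB x))"
      using admissible_convex(2)[OF uB_admissible v, of t] t by simp
    also have "\<dots> = t * (?d + t / 2 * ?N)" by (simp add: power2_eq_square algebra_simps)
    finally show ?thesis using t by (simp add: zero_le_mult_iff)
  qed
  then have ev: "\<forall>\<^sub>F t in at_right 0. 0 \<le> ?d + t / 2 * ?N"
    by (auto simp: eventually_at_right_field intro!: exI[of _ 1])
  have "((\<lambda>t. ?d + t / 2 * ?N) \<longlongrightarrow> ?d + 0 / 2 * ?N) (at_right 0)"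
    by (intro tendsto_intros) auto
  from tendsto_lowerbound[OF this ev] show ?thesis by simp
qed

text \<open>
  Test the first-order condition with the pointwise minimizer \<open>sel (P x)\<close> on \<open>B\<close>: the excess of
  \<open>P u\<^sub>B + g(u\<^sub>B)\<close> over its pointwise minimum is nonnegative and has nonpositive integral.
\<close>

lemma pointwise_minimum_principle:
  "AE x in M. x \<in> B \<longrightarrow> P x * uB x + h (uB x) = H (P x)"
proof -
  define v where "v x = indicator B x * sel (P x)" for x
  have v: "admissible v"
    using patched_control_admissible[of "{}" B] B_sets by (simp add: v_def[abs_def])
  have Bv: "indicator B x * v x = v x" for x by (simp add: v_def indicator_def)
  define k where "k x = (P x * uB x + h (uB x)) - (P x * v x + h (v x))" for x
  have int: "integrable M (\<lambda>x. P x * (v x - uB x))" "integrable M (\<lambda>x. h (v x))" "integrable M (\<lambda>x. h (uB x))"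
    using L2_mult_integrable[OF P_L2 L2_diff[OF admissible_L2[OF v] uB_L2]] v uB_admissible
    by (auto simp: admissible_def)
  have k_eq: "k = (\<lambda>x. - (P x * (v x - uB x)) - h (v x) + h (uB x))"
    by (auto simp: k_def algebra_simps)
  have kint: "integrable M k" unfolding k_eq using int by simp
  have "(LINT x|M. k x) = - (LINT x|M. P x * (v x - uB x)) - (LINT x|M. h (v x)) + (LINT x|M. h (uB x))"
    unfolding k_eq using int by simp
  then have k_le: "(LINT x|M. k x) \<le> 0"
    using first_order_condition[OF v] by (simp add: Bv)
  have fin: "AE x in M. g (uB x) < \<infinity>" using uB_admissible by (simp add: admissible_def)
  then have nonneg: "AE x in M. 0 \<le> k x"
    using uB_outside
  proof eventually_elim
    case (elim x)
    show ?case
    proof (cases "x \<in> B")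
      case True
      then show ?thesis using H_le[OF elim(1), of "P x"] by (simp add: k_def v_def H_def)
    next
      case False
      then show ?thesis using elim(2) by (simp add: k_def v_def)
    qed
  qed
  then have "(LINT x|M. k x) = 0" using k_le integral_nonneg_AE[OF nonneg] by linarith
  then have "AE x in M. k x = 0" using integral_nonneg_eq_0_iff_AE[OF kint nonneg] by simp
  then show ?thesis by eventually_elim (simp add: k_def v_def H_def)
qed

section \<open>Expansion of the value function\<close>

definition sensitivity where "sensitivity x = \<beta> x + H (P x)"

lemma sensitivity_integrable: "integrable M sensitivity"
  unfolding sensitivity_def[abs_def] using \<beta>_integrable H_P_integrable by simp

lemma indicator_diff_sensitivity_integrable:
  assumes "A \<in> sets lebesgue"
  shows "integrable M (\<lambda>x. (indicator A x - indicator B x) * sensitivity x)"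
  using indicator_mult_integrable[OF assms sensitivity_integrable]
    indicator_mult_integrable[OF B_sets sensitivity_integrable]
  by (simp add: left_diff_distrib)

text \<open>
  Compare the integrands in the expansion of the cost pointwise. On \<open>A \<inter> B\<close> and \<open>A - B\<close> the estimate
  is minimality of \<open>H(P)\<close>, together with \<open>P u\<^sub>B + g(u\<^sub>B) = H(P)\<close> and \<open>u\<^sub>B = 0\<close> respectively;
  outside \<open>A\<close> it follows from \<open>g(u) \<ge> 0\<close>. The square of the norm is discarded.
\<close>

lemma real_cost_lower_bound:
  assumes A: "A \<in> sets lebesgue" and u: "admissible u"
  shows "real_cost uB B + (LINT x|M. (indicator A x - indicator B x) * sensitivity x) \<le> real_cost u A"
proof -
  let ?k = "\<lambda>x. P x * (indicator A x * u x - uB x) + h (u x) - h (uB x)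
    + (indicator A x - indicator B x) * \<beta> x"
  have fin: "AE x in M. g (u x) < \<infinity>" using u by (simp add: admissible_def)
  have "AE x in M. (indicator A x - indicator B x) * sensitivity x \<le> ?k x"
    using fin uB_outside pointwise_minimum_principle
  proof eventually_elim
    case (elim x)
    then show ?case
      using H_le[OF elim(1), of "P x"] h_nonneg[of "u x"]
      by (cases "x \<in> A"; cases "x \<in> B") (auto simp: sensitivity_def algebra_simps)
  qed
  then have "(LINT x|M. (indicator A x - indicator B x) * sensitivity x) \<le> (LINT x|M. ?k x)"
    by (intro integral_mono_AE indicator_diff_sensitivity_integrable[OF A] cost_expansion(1)[OF A u])
  then show ?thesis
    using cost_expansion(2)[OF A u] zero_le_power2[of "norm (S (\<lambda>x. indicator A x * u x - uB x))"]
    by linarith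
qed

text \<open>
  The control for which all pointwise estimates behind the lower bound are equalities: \<open>u\<^sub>B\<close> on
  \<open>A \<inter> B\<close>, the pointwise minimizer on \<open>A - B\<close>, and \<open>0\<close> elsewhere. It differs from \<open>u\<^sub>B\<close> only where
  \<open>A\<close> and \<open>B\<close> differ.
\<close>

lemma real_cost_competitor:
  assumes A: "A \<in> sets lebesgue"
  obtains v w where "admissible v" "w \<in> Lp_space 2 \<Omega>"
    "AE x in M. \<bar>w x\<bar> \<le> R * indicator (A - B \<union> (B - A)) x"
    "real_cost v A = real_cost uB B + (LINT x|M. (indicator A x - indicator B x) * sensitivity x)
      + 1 / 2 * (norm (S w))\<^sup>2"
proof -
  define v where "v = (\<lambda>x. indicator (A \<inter> B) x * uB x + indicator (A - B) x * sel (P x))"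
  have v: "admissible v"
    unfolding v_def using A B_sets by (intro patched_control_admissible) auto
  let ?w = "\<lambda>x. indicator A x * v x - uB x"
  let ?k = "\<lambda>x. P x * ?w x + h (v x) - h (uB x) + (indicator A x - indicator B x) * \<beta> x"
  have w: "?w \<in> Lp_space 2 \<Omega>"
    by (rule L2_diff[OF L2_indicator[OF A admissible_L2[OF v]] uB_L2])
  have "AE x in M. \<bar>?w x\<bar> \<le> R * indicator (A - B \<union> (B - A)) x"
    using uB_outside admissible_AE_bound[OF uB_admissible]
  proof eventually_elim
    case (elim x)
    then show ?case
      using abs_sel[of "P x"] by (cases "x \<in> A"; cases "x \<in> B") (auto simp: v_def)
  qed
  moreover have "(LINT x|M. ?k x) = (LINT x|M. (indicator A x - indicator B x) * sensitivity x)"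
  proof (rule integral_cong_AE)
    show "AE x in M. ?k x = (indicator A x - indicator B x) * sensitivity x"
      using uB_outside pointwise_minimum_principle
    proof eventually_elim
      case (elim x)
      then show ?case
        by (cases "x \<in> A"; cases "x \<in> B") (auto simp: v_def sensitivity_def H_def algebra_simps)
    qed
  qed (use cost_expansion(1)[OF A v] indicator_diff_sensitivity_integrable[OF A] in auto)
  ultimately show ?thesis
    using that[OF v w] cost_expansion(2)[OF A v] by simp
qed

definition V :: "'a set \<Rightarrow> real" where "V A = real_of_ereal (value_function \<Omega> S yd g \<beta> A)"

lemma value_function_eq_V: "A \<in> sets lebesgue \<Longrightarrow> value_function \<Omega> S yd g \<beta> A = ereal (V A)"
  by (rule value_function_real[of A]) (auto simp: V_def)

lemma V_le: "A \<in> sets lebesgue \<Longrightarrow> admissible u \<Longrightarrow> V A \<le> real_cost u A"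
  by (rule value_function_real[of A]) (auto simp: V_def)

lemma le_V: "A \<in> sets lebesgue \<Longrightarrow> (\<And>u. admissible u \<Longrightarrow> c \<le> real_cost u A) \<Longrightarrow> c \<le> V A"
  by (rule value_function_real[of A]) (auto simp: V_def)

lemma V_B: "V B = real_cost uB B"
  by (rule antisym[OF V_le[OF B_sets uB_admissible] le_V[OF B_sets uB_minimal]])

lemma value_function_expansion:
  obtains K where
    "\<And>A. A \<in> sets lebesgue \<Longrightarrow>
      (LINT y|M. (indicator A y - indicator B y) * sensitivity y) \<le> V A - V B"
    "\<And>A D m. A \<in> sets lebesgue \<Longrightarrow> D \<in> lmeasurable \<Longrightarrow> A - B \<union> (B - A) \<subseteq> D \<Longrightarrow>
      measure lebesgue D \<le> m \<Longrightarrow> 0 < m \<Longrightarrow>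
      V A - V B \<le> (LINT y|M. (indicator A y - indicator B y) * sensitivity y) + K * m powr (2 - 2 / q)"
proof -
  obtain K where K: "\<And>w D m. w \<in> Lp_space 2 \<Omega> \<Longrightarrow> D \<in> lmeasurable \<Longrightarrow>
      measure lebesgue D \<le> m \<Longrightarrow> 0 < m \<Longrightarrow>
      AE x in M. \<bar>w x\<bar> \<le> R * indicator D x \<Longrightarrow> (norm (S w))\<^sup>2 \<le> K * m powr (2 - 2 / q)"
    using S_small_support by blast
  show ?thesis
  proof (rule that)
    fix A :: "'a set" assume A: "A \<in> sets lebesgue"
    show "(LINT y|M. (indicator A y - indicator B y) * sensitivity y) \<le> V A - V B"
      using le_V[OF A real_cost_lower_bound[OF A]] V_B by simp
    fix D :: "'a set" and m :: real
    assume D: "D \<in> lmeasurable" "A - B \<union> (B - A) \<subseteq> D" "measure lebesgue D \<le> m" "0 < m"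
    obtain v w where vw: "admissible v" "w \<in> Lp_space 2 \<Omega>"
      "AE x in M. \<bar>w x\<bar> \<le> R * indicator (A - B \<union> (B - A)) x"
      "real_cost v A = real_cost uB B + (LINT x|M. (indicator A x - indicator B x) * sensitivity x)
        + 1 / 2 * (norm (S w))\<^sup>2"
      using real_cost_competitor[OF A] by blast
    have "AE x in M. \<bar>w x\<bar> \<le> R * indicator D x"
      using vw(3)
    proof eventually_elim
      case (elim x)
      have "R * indicator (A - B \<union> (B - A)) x \<le> R * indicator D x"
        using D(2) R_pos by (intro mult_left_mono indicator_leI) auto
      then show ?case using elim by simp
    qed
    from K[OF vw(2) D(1,3,4) this]
    have "1 / 2 * (norm (S w))\<^sup>2 \<le> K * m powr (2 - 2 / q)"
      using zero_le_power2[of "norm (S w)"] by linarith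
    then show "V A - V B
        \<le> (LINT y|M. (indicator A y - indicator B y) * sensitivity y) + K * m powr (2 - 2 / q)"
      using V_le[OF A vw(1)] vw(4) V_B by linarith
  qed
qed

section \<open>The topological derivative\<close>

text \<open>
  The set is changed only inside the ball and on \<open>C\<close>, the side of \<open>B\<close> on which \<open>x\<close> lies. So the
  difference quotient of the value function lies between the ball average of the sensitivity
  restricted to \<open>C\<close>, up to sign, and the same average plus \<open>K \<bar>B\<^sub>r\<bar>\<^bsup>1 - 2/q\<^esup>\<close>.
\<close>

lemma topological_derivative_at_Lebesgue_point:
  assumes x: "x \<in> \<Omega>"
  defines "C \<equiv> (if x \<in> B then B else - B)"
  assumes lim: "((\<lambda>r. (LINT y|lebesgue. indicator (ball x r) y * (indicator \<Omega> y * (indicator C y * sensitivity y)))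
      / measure lebesgue (ball x r)) \<longlongrightarrow> sensitivity x) (at_right 0)"
  shows "has_topological_derivative \<Omega> (value_function \<Omega> S yd g \<beta>) B x (topological_sign B x * sensitivity x)"
proof -
  let ?\<sigma> = "topological_sign B x" and ?m = "\<lambda>r. measure lebesgue (ball x r)"
  let ?A = "\<lambda>r. if x \<in> B then B - ball x r else (B \<union> ball x r) \<inter> \<Omega>"
  let ?I = "\<lambda>r. LINT y|lebesgue. indicator (ball x r) y * (indicator \<Omega> y * (indicator C y * sensitivity y))"
  obtain K where K:
    "\<And>A. A \<in> sets lebesgue \<Longrightarrow>
      (LINT y|M. (indicator A y - indicator B y) * sensitivity y) \<le> V A - V B"
    "\<And>A D m. A \<in> sets lebesgue \<Longrightarrow> D \<in> lmeasurable \<Longrightarrow> A - B \<union> (B - A) \<subseteq> D \<Longrightarrow>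
      measure lebesgue D \<le> m \<Longrightarrow> 0 < m \<Longrightarrow>
      V A - V B \<le> (LINT y|M. (indicator A y - indicator B y) * sensitivity y) + K * m powr (2 - 2 / q)"
    using value_function_expansion by blast
  have A: "?A r \<in> sets lebesgue" for r using B_sets \<Omega>_sets by (auto intro!: sets.Int sets.Un)
  have sub: "?A r - B \<union> (B - ?A r) \<subseteq> ball x r" for r using B_sub by auto
  have I: "(LINT y|M. (indicator (?A r) y - indicator B y) * sensitivity y) = ?\<sigma> * ?I r" for r
  proof -
    have "(LINT y|M. (indicator (?A r) y - indicator B y) * sensitivity y)
        = (LINT y|lebesgue. indicator \<Omega> y *\<^sub>R ((indicator (?A r) y - indicator B y) * sensitivity y))"
      using \<Omega>_sets by (intro integral_restrict_space) simp
    also have "\<dots> = (LINT y|lebesgue. ?\<sigma> * (indicator (ball x r) y * (indicator \<Omega> y * (indicator C y * sensitivity y))))"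
      using B_sub
      by (intro Bochner_Integration.integral_cong refl)
         (auto simp: C_def topological_sign_def indicator_def)
    finally show ?thesis by simp
  qed
  have pos: "\<forall>\<^sub>F r in at_right 0. 0 < ?m r"
    unfolding eventually_at_right_field using content_ball_pos by (intro exI[of _ 1]) auto
  have "((\<lambda>r. (V (?A r) - V B) / ?m r) \<longlongrightarrow> ?\<sigma> * sensitivity x) (at_right 0)"
  proof (rule tendsto_sandwich)
    show "\<forall>\<^sub>F r in at_right 0. ?\<sigma> * (?I r / ?m r) \<le> (V (?A r) - V B) / ?m r"
      using pos
    proof eventually_elim
      case (elim r)
      then show ?case using K(1)[OF A[of r]] by (simp add: I divide_right_mono)
    qed
    show "\<forall>\<^sub>F r in at_right 0. (V (?A r) - V B) / ?m r \<le> ?\<sigma> * (?I r / ?m r) + K * ?m r powr (1 - 2 / q)"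
      using pos
    proof eventually_elim
      case (elim r)
      have "V (?A r) - V B \<le> ?\<sigma> * ?I r + K * ?m r powr (2 - 2 / q)"
        using K(2)[OF A[of r] lmeasurable_ball sub order_refl elim] by (simp only: I)
      then have "(V (?A r) - V B) / ?m r \<le> (?\<sigma> * ?I r + K * ?m r powr (2 - 2 / q)) / ?m r"
        using elim by (intro divide_right_mono) auto
      also have "\<dots> = ?\<sigma> * (?I r / ?m r) + K * (?m r powr (2 - 2 / q) / ?m r powr 1)"
        using elim by (simp add: add_divide_distrib)
      also have "?m r powr (2 - 2 / q) / ?m r powr 1 = ?m r powr (1 - 2 / q)"
        by (simp only: powr_diff[symmetric]) simp
      finally show ?case .
    qed
    show "((\<lambda>r. ?\<sigma> * (?I r / ?m r)) \<longlongrightarrow> ?\<sigma> * sensitivity x) (at_right 0)"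
      by (intro tendsto_mult_left lim)
    have "((\<lambda>r. ?m r powr (1 - 2 / q)) \<longlongrightarrow> 0) (at_right 0)"
      using q_gt by (intro tendsto_zero_powrI[OF measure_small_ball_tendsto_0 tendsto_const]) auto
    then have "((\<lambda>r. ?\<sigma> * (?I r / ?m r) + K * ?m r powr (1 - 2 / q)) \<longlongrightarrow> ?\<sigma> * sensitivity x + K * 0) (at_right 0)"
      by (intro tendsto_add tendsto_mult_left lim)
    then show "((\<lambda>r. ?\<sigma> * (?I r / ?m r) + K * ?m r powr (1 - 2 / q)) \<longlongrightarrow> ?\<sigma> * sensitivity x) (at_right 0)"
      by simp
  qed
  then have "((\<lambda>r. ereal ((V (?A r) - V B) / ?m r)) \<longlongrightarrow> ereal (?\<sigma> * sensitivity x)) (at_right 0)"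
    by (rule tendsto_ereal)
  moreover have "\<forall>\<^sub>F r in at_right 0. ereal ((V (?A r) - V B) / ?m r)
      = (value_function \<Omega> S yd g \<beta> (?A r) - value_function \<Omega> S yd g \<beta> B) / ereal (?m r)"
    using pos by eventually_elim (simp only: value_function_eq_V[OF A] value_function_eq_V[OF B_sets], simp)
  ultimately show ?thesis
    unfolding has_topological_derivative_def by (rule Lim_transform_eventually)
qed

lemma topological_derivative_AE:
  "AE x in M. has_topological_derivative \<Omega> (value_function \<Omega> S yd g \<beta>) B x
    (topological_sign B x * (\<beta> x + H (pB x)))"
proof -
  have int: "integrable lebesgue (\<lambda>y. indicator \<Omega> y * (indicator C y * sensitivity y))"
    if "C \<in> sets lebesgue" for C
    using indicator_mult_integrable[OF that sensitivity_integrable] \<Omega>_sets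
    by (subst (asm) integrable_restrict_space) auto
  have mB: "- B \<in> sets lebesgue" using B_sets by (simp add: Compl_in_sets_lebesgue)
  have "AE x in lebesgue. x \<in> \<Omega> \<longrightarrow> has_topological_derivative \<Omega> (value_function \<Omega> S yd g \<beta>) B x
      (topological_sign B x * sensitivity x)"
    using Lebesgue_differentiation_balls[OF int[OF B_sets]] Lebesgue_differentiation_balls[OF int[OF mB]]
  proof eventually_elim
    case (elim x)
    show ?case
    proof
      assume x: "x \<in> \<Omega>"
      show "has_topological_derivative \<Omega> (value_function \<Omega> S yd g \<beta>) B x (topological_sign B x * sensitivity x)"
        by (rule topological_derivative_at_Lebesgue_point[OF x]) (use elim x in auto)
    qed
  qed
  then have "AE x in M. has_topological_derivative \<Omega> (value_function \<Omega> S yd g \<beta>) B x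
      (topological_sign B x * sensitivity x)"
    using \<Omega>_sets by (subst AE_restrict_space_iff) auto
  then show ?thesis
    using pB_eq by eventually_elim (simp add: sensitivity_def P_def)
qed

end

theorem theorem5p5:
  fixes \<Omega> B :: "(real ^ 'd) set"
    and S :: "(real ^ 'd \<Rightarrow> real) \<Rightarrow> 'y::{real_inner, complete_space}"
    and Sadj :: "'y \<Rightarrow> real ^ 'd \<Rightarrow> real"
    and yd yB :: 'y
    and g :: "real \<Rightarrow> ereal"
    and \<beta> uB pB :: "real ^ 'd \<Rightarrow> real"
    and q :: real
  assumes "\<Omega> \<in> sets lebesgue" and "emeasure lebesgue \<Omega> < \<infinity>"
    and "bounded_linear_from_L2 \<Omega> S"
    and "is_L2_adjoint \<Omega> S Sadj"
    and "ereal_proper g" and "ereal_convex g" and "lower_semicontinuous g"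
    and "\<And>u. g u \<ge> 0" and "\<And>u. g u = 0 \<longleftrightarrow> u = 0"
    and "bounded (ereal_dom g)"
    and "q > 3" and "bounded_linear_to_Lp q \<Omega> Sadj"
    and "integrable (lebesgue_on \<Omega>) \<beta>"
    and "B \<in> sets lebesgue" and "B \<subseteq> \<Omega>"
    and "is_solution \<Omega> S Sadj yd g \<beta> B uB yB pB"
  shows "AE x in lebesgue_on \<Omega>. \<exists>D::real.
           has_topological_derivative \<Omega> (value_function \<Omega> S yd g \<beta>) B x D \<and>
           ereal D = ereal (topological_sign B x) * (ereal (\<beta> x) + hamiltonian g (pB x))"
proof -
  interpret control_solution g \<Omega> S Sadj yd \<beta> q B uB yB pB
    using assms by unfold_locales auto
  show ?thesis
    using topological_derivative_AE
  proof eventually_elim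
    case (elim x)
    then show ?case
      by (intro exI[of _ "topological_sign B x * (\<beta> x + H (pB x))"]) (simp add: hamiltonian_eq)
  qed
qed

end
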